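(* Consider the stochastic network with exogenous Markov state process $S(t)$, queue backlogs $\boldsymbol{q}(t)\in\mathbb{R}^r_+$, $\boldsymbol{q}(0)=\boldsymbol{0}$, and the algorithm QLA with parameter $V\ge 1$, all as defined in the context. Suppose there is a state $s_1\in\mathcal{S}$ such that $\overline{T_{j1}^2}<\infty$ for every state $s_j\in\mathcal{S}$ (including $s_j=s_1$), where $T_{j1}$ is the first hitting time of $s_1$ starting from $s_j$. Suppose also that the $\eta$-slackness condition holds: there exist $\eta>0$, actions $x^{(s_i)}_k\in\mathcal{X}^{(s_i)}$ and numbers $\vartheta^{(s_i)}_k\ge 0$ ($s_i\in\mathcal{S}$, $k=1,\dots,r+2$) with $\sum_{k}\vartheta^{(s_i)}_k=1$ for every $s_i$, such that for every $j=1,\dots,r$, $$\sum_{s_i}\pi_{s_i}\Big\{\sum_{k=1}^{r+2}\vartheta^{(s_i)}_k\big[A_j(s_i,x^{(s_i)}_k)-\mu_j(s_i,x^{(s_i)}_k)\big]\Big\}\le-\eta .$$ Let $\overline{T_1}$ and $\overline{T_1^2}$ be the first and second moments of the first return time of $S(t)$ to $s_1$, and set $C=\overline{T_1^2}+\overline{T_1}$, $D=\overline{T_1^2}-\overline{T_1}$, $B=\sqrt{r}\,\delta_{max}$. Then, for every initial state $S(0)\in\mathcal{S}$, under QLA $$f^{QLA}_{av}\le f^*_{av}+\frac{CB^2}{V\,\overline{T_1}},$$ $$\overline{\sum_{j=1}^r q_j}\;\le\;\frac{CB^2+\overline{T_1}\,V\delta_{max}}{\eta}+\frac{DB^2}{2},$$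 where $f^{QLA}_{av}$ is the time average expected cost under QLA, $f^*_{av}$ is the optimal time average cost over all stable policies, and $\overline{\sum_{j} q_j}=\limsup_{t\to\infty}\frac1t\sum_{\tau=0}^{t-1}\sum_{j=1}^r\mathbb{E}\{q_j(\tau)\}$ is the time average expected backlog under QLA.
   Context: Network model. Time is slotted, $t\in\{0,1,2,\dots\}$, and there are $r\ge1$ queues. The network state $S(t)$ evolves as an irreducible, aperiodic (time-homogeneous) Markov chain on a countable state space $\mathcal{S}=\{s_1,s_2,\dots\}$, unaffected by the control actions, and has a stationary distribution $(\pi_{s_i})$ (so all states are positive recurrent and $\pi_{s_i}>0$). In slot $t$ the controller observes $S(t)=s_i$ and chooses an action $x(t)=x$ from a time-invariant compact set $\mathcal{X}^{(s_i)}$. This incurs a cost $f(t)=f(s_i,x)$, generates traffic $A_j(t)=A_j(s_i,x)\ge 0$ to queue $j$, and allocates service $\mu_j(t)=\mu_j(s_i,x)\ge 0$ to queue $j$, $j=1,\dots,r$. The cost takes values in $\mathbb{R}_+=[0,\infty)$ (or, in reward maximization problems, in $\mathbb{R}_-=(-\infty,0]$). All functions $f(s_i,\cdot),A_j(s_i,\cdot),\mu_j(s_i,\cdot)$ are time-invariant and bounded in magnitude by one constant $\delta_{max}\in(0,\infty)$, for all $s_i$ and $j$. Queues. $q_j(t+1)=\max[q_j(t)-\mu_j(t),0]+A_j(t)$ for all $j$, with $\boldsymbol{q}(0)=\boldsymbol{0}$. Policies. A (possibly randomized) action-choosing policy $\Pi$ is feasible if in each slot $t$ it chooses an action in $\mathcal{X}^{(S(t))}$.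 Its time average cost is $f^{\Pi}_{av}=\limsup_{t\to\infty}\frac1t\sum_{\tau=0}^{t-1}\mathbb{E}\{f^{\Pi}(\tau)\}$, where $f^{\Pi}(\tau)$ is the cost incurred in slot $\tau$. A feasible policy is stable if $\limsup_{t\to\infty}\frac1t\sum_{\tau=0}^{t-1}\sum_{j=1}^r\mathbb{E}\{q_j(\tau)\}<\infty$. $f^*_{av}$ denotes the optimal (infimum) time average cost over all stable policies. QLA with parameter $V\ge1$. In every slot $t$, observe $S(t)$ and $\boldsymbol{q}(t)$; if $S(t)=s_i$, choose an action $x\in\mathcal{X}^{(s_i)}$ that maximizes $-Vf(s_i,x)+\sum_{j=1}^r q_j(t)\big[\mu_j(s_i,x)-A_j(s_i,x)\big]$ over $\mathcal{X}^{(s_i)}$ (a maximizer is taken to exist). Hitting and return times. $T_{ji}$ denotes $\inf\{T>0: S(t_0+T)=s_i\}$ given $S(t_0)=s_j$; its distribution does not depend on $t_0$. $\overline{T_{ji}}$ and $\overline{T_{ji}^2}$ are its first and second moments. The return time to $s_i$ is $T_i=T_{ii}$, with moments $\overline{T_i}$, $\overline{T_i^2}$. *)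

theory Defs
  imports "HOL-Probability.Probability"
begin

section \<open>The exogenous Markov chain\<close>

primrec kernel_pow :: "('s \<Rightarrow> 's pmf) \<Rightarrow> nat \<Rightarrow> 's \<Rightarrow> 's pmf" where
  "kernel_pow K 0 s = return_pmf s"
| "kernel_pow K (Suc n) s = bind_pmf (K s) (kernel_pow K n)"

definition irreducible_kernel :: "('s \<Rightarrow> 's pmf) \<Rightarrow> bool" where
  "irreducible_kernel K \<longleftrightarrow> (\<forall>s s'. \<exists>n. 0 < pmf (kernel_pow K n s) s')"

definition aperiodic_kernel :: "('s \<Rightarrow> 's pmf) \<Rightarrow> bool" where
  "aperiodic_kernel K \<longleftrightarrow> (\<forall>s. Gcd {n. 0 < n \<and> 0 < pmf (kernel_pow K n s) s} = 1)"

definition stationary_distribution :: "('s \<Rightarrow> 's pmf) \<Rightarrow> 's pmf \<Rightarrow> bool" where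
  "stationary_distribution K \<pi> \<longleftrightarrow> bind_pmf \<pi> K = \<pi>"

text \<open>The law on path space of the chain with kernel \<open>K\<close> started in \<open>s\<close>, obtained from the
  Ionescu-Tulcea theorem; \<open>emeasure_chain_law_cylinder\<close> below confirms its finite-dimensional
  distributions.\<close>

definition chain_step :: "('s \<Rightarrow> 's pmf) \<Rightarrow> 's \<Rightarrow> nat \<Rightarrow> (nat \<Rightarrow> 's) \<Rightarrow> 's measure" where
  "chain_step K s n \<omega> = measure_pmf (if n = 0 then return_pmf s else K (\<omega> (n - 1)))"

definition chain_law :: "('s \<Rightarrow> 's pmf) \<Rightarrow> 's \<Rightarrow> (nat \<Rightarrow> 's) measure" where
  "chain_law K s =
     projective_family.lim UNIV
       (Ionescu_Tulcea.CI (chain_step K s) (\<lambda>_. count_space UNIV)) (\<lambda>_. count_space UNIV)"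

text \<open>The infimum of the empty set is \<open>\<infinity>\<close> (the state is never hit).\<close>

definition hitting_time :: "'s \<Rightarrow> (nat \<Rightarrow> 's) \<Rightarrow> ennreal" where
  "hitting_time s \<omega> = (INF n\<in>{n. 0 < n \<and> \<omega> n = s}. of_nat n)"

definition hitting_moment :: "('s \<Rightarrow> 's pmf) \<Rightarrow> nat \<Rightarrow> 's \<Rightarrow> 's \<Rightarrow> ennreal" where
  "hitting_moment K p s' s = (\<integral>\<^sup>+\<omega>. hitting_time s \<omega> ^ p \<partial>chain_law K s')"

lemma Ionescu_Tulcea_chain_step:
  fixes K :: "'s::countable \<Rightarrow> 's pmf"
  shows "Ionescu_Tulcea (chain_step K s) (\<lambda>_. count_space UNIV)"
proof (rule Ionescu_Tulcea.intro)
  fix i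
  show "chain_step K s i \<in> measurable (PiM {0..<i} (\<lambda>_. count_space UNIV))
          (subprob_algebra (count_space UNIV))"
  proof (cases "i = 0")
    case True
    then show ?thesis
      by (simp add: chain_step_def[abs_def] measure_pmf_in_subprob_algebra)
  next
    case False
    have 1: "(\<lambda>\<omega>::nat \<Rightarrow> 's. \<omega> (i - 1)) \<in>
        measurable (PiM {0..<i} (\<lambda>_. count_space UNIV)) (count_space UNIV)"
      using False by (intro measurable_component_singleton) auto
    have 2: "(\<lambda>s. measure_pmf (K s)) \<in>
        measurable (count_space UNIV) (subprob_algebra (count_space UNIV))"
      by (simp add: measure_pmf_in_subprob_algebra)
    show ?thesis
      using measurable_compose[OF 1 2] False by (simp add: chain_step_def[abs_def])
  qed
next
  fix i and x :: "nat \<Rightarrow> 's"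
  show "prob_space (chain_step K s i x)"
    by (simp add: chain_step_def prob_space_measure_pmf)
qed

lemma prob_space_chain_law:
  fixes K :: "'s::countable \<Rightarrow> 's pmf"
  shows "prob_space (chain_law K s)"
proof -
  interpret IT: Ionescu_Tulcea "chain_step K s" "\<lambda>_. count_space UNIV"
    by (rule Ionescu_Tulcea_chain_step)
  have "emeasure (chain_law K s) (space (chain_law K s)) =
      emeasure (IT.CI {}) (space (IT.CI {}))"
    using IT.lim[of "{}" "{\<lambda>_. undefined}"]
    by (simp add: chain_law_def IT.PF.space_P space_PiM PiE_UNIV_domain prod_emb_def sets_PiM_empty
        vimage_def restrict_def)
  also have "\<dots> = 1"
    by (intro prob_space.emeasure_space_1 IT.PF.prob_space_P) auto
  finally show ?thesis
    by (rule prob_spaceI)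
qed

lemma emeasure_chain_law_cylinder:
  fixes K :: "'s::countable \<Rightarrow> 's pmf"
  shows "emeasure (chain_law K s) {\<omega>. \<forall>i\<le>n. \<omega> i = p i} =
           (if p 0 = s then (\<Prod>i<n. ennreal (pmf (K (p i)) (p (Suc i)))) else 0)"
proof -
  interpret IT: Ionescu_Tulcea "chain_step K s" "\<lambda>_. count_space UNIV"
    by (rule Ionescu_Tulcea_chain_step)
  let ?P = "\<lambda>n. PiM {0..<n} (\<lambda>_::nat. count_space (UNIV::'s set))"
  let ?u = "\<lambda>_::nat. undefined :: 's"
  let ?X = "\<lambda>n. PiE {0..<n} (\<lambda>i. {p i})"
  have X_sets [measurable]: "?X n \<in> sets (?P n)" for n
    by (intro sets_PiM_I_finite) auto
  have u: "?u \<in> space (?P 0)"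
    by (simp add: space_PiM)
  have upd: "emeasure (IT.eP n \<omega>) (?X (Suc n)) =
      (if n = 0 then indicator {s} (p 0) else ennreal (pmf (K (p (n - 1))) (p n)))
        * indicator (?X n) \<omega>"
    if "\<omega> \<in> space (?P n)" for n \<omega>
  proof -
    have *: "fun_upd \<omega> n -` ?X (Suc n) = (if \<omega> \<in> ?X n then {p n} else {})"
      using that
      by (auto simp: space_PiM PiE_iff extensional_def less_Suc_eq split: if_splits)
    have **: "\<omega> (n - 1) = p (n - 1)" if "\<omega> \<in> ?X n" "n \<noteq> 0"
      using PiE_mem[OF that(1), of "n - 1"] that(2) by simp
    show ?thesis
      unfolding IT.emeasure_eP[OF that X_sets] *
      using ** by (simp add: chain_step_def emeasure_pmf_single indicator_def)
  qed
  have C: "emeasure (IT.C 0 (Suc n) ?u) (?X (Suc n)) =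
      (if p 0 = s then (\<Prod>i<n. ennreal (pmf (K (p i)) (p (Suc i)))) else 0)" for n
  proof (induction n)
    case 0
    have "IT.C 0 (Suc 0) ?u = IT.eP 0 ?u"
      using bind_return[OF IT.measurable_eP[of 0] u] by simp
    then show ?case
      using upd[OF u] by (simp del: IT.C.simps)
  next
    case (Suc n)
    have "emeasure (IT.C 0 (Suc (Suc n)) ?u) (?X (Suc (Suc n))) =
        (\<integral>\<^sup>+\<omega>. emeasure (IT.eP (Suc n) \<omega>) (?X (Suc (Suc n))) \<partial>IT.C 0 (Suc n) ?u)"
    proof -
      have "IT.eP (Suc n) \<in> measurable (IT.C 0 (Suc n) ?u) (subprob_algebra (?P (Suc (Suc n))))"
        using IT.measurable_eP[of "Suc n"]
        unfolding measurable_cong_sets[OF IT.sets_C[OF u, of "Suc n"] refl] add_0 .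
      moreover have "space (IT.C 0 (Suc n) ?u) \<noteq> {}"
        using IT.space_C[OF u, of "Suc n"] by (simp add: space_PiM PiE_eq_empty_iff del: IT.C.simps)
      ultimately show ?thesis
        unfolding IT.C.simps(2)[of 0 "Suc n"] add_0
        by (intro emeasure_bind[OF _ _ X_sets])
    qed
    also have "\<dots> = (\<integral>\<^sup>+\<omega>. ennreal (pmf (K (p n)) (p (Suc n))) * indicator (?X (Suc n)) \<omega>
        \<partial>IT.C 0 (Suc n) ?u)"
      using IT.space_C[OF u, of "Suc n"]
      by (intro nn_integral_cong, subst upd) (auto simp del: IT.C.simps)
    also have "\<dots> = ennreal (pmf (K (p n)) (p (Suc n))) * emeasure (IT.C 0 (Suc n) ?u) (?X (Suc n))"
      using IT.sets_C[OF u, of "Suc n"] X_sets[of "Suc n"]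
      by (intro nn_integral_cmult_indicator) (simp del: IT.C.simps)
    finally show ?case
      unfolding Suc.IH by (simp add: mult.commute)
  qed
  have "{\<omega>. \<forall>i\<le>n. \<omega> i = p i} = IT.PF.emb UNIV {0..<Suc n} (?X (Suc n))"
    by (auto simp: prod_emb_def space_PiM PiE_iff less_Suc_eq_le)
  then have "emeasure (chain_law K s) {\<omega>. \<forall>i\<le>n. \<omega> i = p i} = emeasure (IT.CI {0..<Suc n}) (?X (Suc n))"
    unfolding chain_law_def using IT.lim[OF _ X_sets[of "Suc n"]] by simp
  also have "\<dots> = emeasure (IT.C 0 (Suc n) ?u) (?X (Suc n))"
    by (subst IT.emeasure_CI[OF order_refl X_sets])
       (simp add: prod_emb_id PiE_iff space_PiM sets.sets_into_space[OF X_sets] subset_iff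
         del: IT.C.simps)
  finally show ?thesis
    unfolding C .
qed

section \<open>The controlled queueing network\<close>

text \<open>Queues are numbered \<open>1, \<dots>, num_queues N\<close>; arrival and service functions at other indices
  are irrelevant.\<close>

record ('s, 'a) network =
  num_queues :: nat
  kernel :: "'s \<Rightarrow> 's pmf"
  actions :: "'s \<Rightarrow> 'a set"
  cost :: "'s \<Rightarrow> 'a \<Rightarrow> real"
  arrival :: "nat \<Rightarrow> 's \<Rightarrow> 'a \<Rightarrow> real"
  service :: "nat \<Rightarrow> 's \<Rightarrow> 'a \<Rightarrow> real"

locale stochastic_network =
  fixes N :: "('s::countable, 'a::topological_space) network"
    and \<pi> :: "'s pmf"
    and \<delta> :: real
  assumes num_queues_ge_1: "1 \<le> num_queues N"
    and irreducible: "irreducible_kernel (kernel N)"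
    and aperiodic: "aperiodic_kernel (kernel N)"
    and stationary: "stationary_distribution (kernel N) \<pi>"
    and compact_actions: "compact (actions N s)"
    and \<delta>_pos: "0 < \<delta>"
    and cost_sign: "(\<forall>s. \<forall>a\<in>actions N s. 0 \<le> cost N s a) \<or>
                    (\<forall>s. \<forall>a\<in>actions N s. cost N s a \<le> 0)"
    and cost_bounded: "a \<in> actions N s \<Longrightarrow> \<bar>cost N s a\<bar> \<le> \<delta>"
    and arrival_nonneg: "j \<in> {1..num_queues N} \<Longrightarrow> a \<in> actions N s \<Longrightarrow> 0 \<le> arrival N j s a"
    and arrival_bounded: "j \<in> {1..num_queues N} \<Longrightarrow> a \<in> actions N s \<Longrightarrow> arrival N j s a \<le> \<delta>"
    and service_nonneg: "j \<in> {1..num_queues N} \<Longrightarrow> a \<in> actions N s \<Longrightarrow> 0 \<le> service N j s a"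
    and service_bounded: "j \<in> {1..num_queues N} \<Longrightarrow> a \<in> actions N s \<Longrightarrow> service N j s a \<le> \<delta>"

text \<open>Backlog of queue \<open>j\<close> along a state trajectory \<open>\<sigma>\<close> and an action trajectory \<open>\<alpha>\<close>.\<close>

primrec queue ::
  "('s, 'a) network \<Rightarrow> nat \<Rightarrow> (nat \<Rightarrow> 's) \<Rightarrow> (nat \<Rightarrow> 'a) \<Rightarrow> nat \<Rightarrow> real" where
  "queue N j \<sigma> \<alpha> 0 = 0"
| "queue N j \<sigma> \<alpha> (Suc t) =
     max (queue N j \<sigma> \<alpha> t - service N j (\<sigma> t) (\<alpha> t)) 0 + arrival N j (\<sigma> t) (\<alpha> t)"

definition slackness :: "('s, 'a) network \<Rightarrow> 's pmf \<Rightarrow> real \<Rightarrow> bool" where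
  "slackness N \<pi> \<eta> \<longleftrightarrow>
     (\<exists>(x :: 's \<Rightarrow> nat \<Rightarrow> 'a) (\<theta> :: 's \<Rightarrow> nat \<Rightarrow> real).
        (\<forall>s. \<forall>k\<in>{1..num_queues N + 2}. x s k \<in> actions N s \<and> 0 \<le> \<theta> s k) \<and>
        (\<forall>s. (\<Sum>k=1..num_queues N + 2. \<theta> s k) = 1) \<and>
        (\<forall>j\<in>{1..num_queues N}.
           (\<Sum>\<^sub>\<infinity>s. pmf \<pi> s *
              (\<Sum>k=1..num_queues N + 2. \<theta> s k * (arrival N j s (x s k) - service N j s (x s k))))
           \<le> - \<eta>))"

section \<open>Feasible policies\<close>

text \<open>
  The system run by a feasible, possibly randomized and history-dependent policy from initial
  state \<open>s0\<close>.  The \<open>\<sigma>\<close>-algebra \<open>F t\<close> is the information available once the action of slot \<open>t\<close>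
  has been chosen, including all randomization used so far.  The Markov property with respect to
  \<open>F\<close> says that the controller cannot anticipate, nor influence, the state process.

  Actions enter only through the cost, arrival and service values, so exactly these are required
  to be measurable; no \<open>\<sigma>\<close>-algebra on the action space and no regularity of \<open>cost N s\<close> etc.
  is needed.
\<close>

locale feasible_policy = prob_space M + filtration "space M" F
  for N :: "('s, 'a) network"
    and s0 :: 's
    and M :: "'w measure"
    and F :: "nat \<Rightarrow> 'w measure"
    and S :: "nat \<Rightarrow> 'w \<Rightarrow> 's"
    and x :: "nat \<Rightarrow> 'w \<Rightarrow> 'a" +
  assumes sub_algebra: "subalgebra M (F t)"
    and S_adapted: "S t \<in> measurable (F t) (count_space UNIV)"
    and S_initial: "AE \<omega> in M. S 0 \<omega> = s0"
    and S_Markov: "AE \<omega> in M.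
          real_cond_exp M (F t) (indicator {\<omega>\<in>space M. S (Suc t) \<omega> = s}) \<omega>
            = pmf (kernel N (S t \<omega>)) s"
    and action_feasible: "AE \<omega> in M. x t \<omega> \<in> actions N (S t \<omega>)"
    and cost_adapted: "(\<lambda>\<omega>. cost N (S t \<omega>) (x t \<omega>)) \<in> borel_measurable (F t)"
    and arrival_adapted: "j \<in> {1..num_queues N} \<Longrightarrow>
          (\<lambda>\<omega>. arrival N j (S t \<omega>) (x t \<omega>)) \<in> borel_measurable (F t)"
    and service_adapted: "j \<in> {1..num_queues N} \<Longrightarrow>
          (\<lambda>\<omega>. service N j (S t \<omega>) (x t \<omega>)) \<in> borel_measurable (F t)"

definition time_avg :: "(nat \<Rightarrow> real) \<Rightarrow> ereal" where
  "time_avg a = limsup (\<lambda>t. ereal ((\<Sum>\<tau><t. a \<tau>) / real t))"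

definition avg_cost ::
  "('s, 'a) network \<Rightarrow> 'w measure \<Rightarrow> (nat \<Rightarrow> 'w \<Rightarrow> 's) \<Rightarrow> (nat \<Rightarrow> 'w \<Rightarrow> 'a) \<Rightarrow> ereal" where
  "avg_cost N M S x = time_avg (\<lambda>\<tau>. \<integral>\<omega>. cost N (S \<tau> \<omega>) (x \<tau> \<omega>) \<partial>M)"

definition avg_backlog ::
  "('s, 'a) network \<Rightarrow> 'w measure \<Rightarrow> (nat \<Rightarrow> 'w \<Rightarrow> 's) \<Rightarrow> (nat \<Rightarrow> 'w \<Rightarrow> 'a) \<Rightarrow> ereal" where
  "avg_backlog N M S x =
     time_avg (\<lambda>\<tau>. \<Sum>j=1..num_queues N. \<integral>\<omega>. queue N j (\<lambda>t. S t \<omega>) (\<lambda>t. x t \<omega>) \<tau> \<partial>M)"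

definition stable_policy where
  "stable_policy N s0 M F S x \<longleftrightarrow> feasible_policy N s0 M F S x \<and> avg_backlog N M S x < \<infinity>"

text \<open>
  The optimal cost ranges over policies realized on the space of state-action trajectories, with
  arbitrary \<open>\<sigma>\<close>-algebras.  This loses no generality: after completing \<open>M\<close>, any realization
  \<open>(M, F, S, x)\<close> is carried over by \<open>\<omega> \<mapsto> (\<lambda>t. (S t \<omega>, x t \<omega>))\<close>, equipping trajectories with the
  finest \<open>\<sigma>\<close>-algebras that make this map measurable, and costs and backlogs are preserved.
\<close>

definition optimal_cost :: "('s, 'a) network \<Rightarrow> 's \<Rightarrow> ereal" where
  "optimal_cost N s0 =
     Inf {avg_cost N M (\<lambda>t \<omega>. fst (\<omega> t)) (\<lambda>t \<omega>. snd (\<omega> t)) | M F.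
            stable_policy N s0 (M :: (nat \<Rightarrow> 's \<times> 'a) measure) F
              (\<lambda>t \<omega>. fst (\<omega> t)) (\<lambda>t \<omega>. snd (\<omega> t))}"

section \<open>The QLA algorithm\<close>

definition QLA_objective ::
  "('s, 'a) network \<Rightarrow> real \<Rightarrow> (nat \<Rightarrow> real) \<Rightarrow> 's \<Rightarrow> 'a \<Rightarrow> real" where
  "QLA_objective N V q s a =
     - V * cost N s a + (\<Sum>j=1..num_queues N. q j * (service N j s a - arrival N j s a))"

text \<open>Ties may be broken arbitrarily, possibly at random.\<close>

locale QLA_policy = feasible_policy N s0 M F S x
  for N :: "('s, 'a) network" and V :: real and s0 M F S x +
  assumes action_maximizes: "AE \<omega> in M.
    is_arg_max (QLA_objective N V (\<lambda>j. queue N j (\<lambda>t. S t \<omega>) (\<lambda>t. x t \<omega>) t) (S t \<omega>))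
      (\<lambda>a. a \<in> actions N (S t \<omega>)) (x t \<omega>)"

end

(*
  The classical argument compares drifts over random return cycles of the state process to s1.
  Here the cycles are replaced by a Poisson equation.  For a backlog vector q let g(s,q) be the
  minimum over actions of V f + sum_j q_j (A_j - mu_j) in state s, and G(q) its stationary mean.
  Lagrange duality gives G(q) <= V f* for every q >= 0, and slackness gives
  G(q) <= V sup f - eta sum_j q_j.  The function h(s,q), the expectation of the sum of g - G up to
  the hitting time of s1, satisfies h - K h = g - G, so replacing g(S(t),q(t)) by G(q(t)) in the
  one-slot Lyapunov drift costs a telescoping term and the change of h when q moves by one slot,
  at most 2 B^2 W(S(t+1)) with W(s) the mean hitting time of s1.  W has time average D / (2 T1)
  (apply the same device to the second moments), hence the total overhead per slot is
  B^2 (1 + D / T1) = B^2 T1sq / T1, which is below C B^2 / T1.  The boundary term h(S(n),q(n)) is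
  absorbed by the quadratic Lyapunov function up to W(S(n))^2, whose mean is o(n) by second
  moments alone.
*)

theory Submission
  imports Defs
begin

section \<open>Taboo expectations and potentials\<close>

text \<open>A policy lives on an arbitrary filtered probability space where only the one-slot Markov
  property is given. Hitting times therefore never appear on that space: they are encoded as
  functions of the state, built from the kernel by taboo recursions, and used only through one-step
  conditional expectations. The path law serves to identify these functions with the moments in the
  statement. Two limits shape the proof. Stationary means of squared hitting times involve third
  moments of the return time, over which there is no control, so the boundary term need not stay
  bounded; truncating the tail still makes it o(n). And stability bounds only averaged backlogs, so
  in G(q) <= V f* the final backlog is not shown to be o(n): linear growth of it is refuted by
  contradiction. The overhead is free of V because the cost cancels in g(s,q) - g(s,q'), so the
  Lipschitz constants of g, G and h in q do not involve V.\<close>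

lemma integrable_measure_pmf_bounded:
  fixes f :: "'a \<Rightarrow> real"
  assumes "\<And>x. \<bar>f x\<bar> \<le> c"
  shows "integrable (measure_pmf p) f"
  using assms by (intro measure_pmf.integrable_const_bound[where B=c]) auto

lemma abs_expectation_le:
  fixes f :: "'a \<Rightarrow> real"
  assumes "\<And>x. \<bar>f x\<bar> \<le> g x" and "integrable (measure_pmf p) g"
  shows "\<bar>measure_pmf.expectation p f\<bar> \<le> measure_pmf.expectation p g"
proof -
  have "integrable (measure_pmf p) f"
    using assms(2) by (rule Bochner_Integration.integrable_bound) (use assms(1) in \<open>auto intro: order_trans[OF _ abs_ge_self]\<close>)
  have "\<bar>measure_pmf.expectation p f\<bar> \<le> measure_pmf.expectation p (\<lambda>x. \<bar>f x\<bar>)"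
    by (rule integral_abs_bound)
  also have "\<dots> \<le> measure_pmf.expectation p g"
    using assms \<open>integrable (measure_pmf p) f\<close> by (intro integral_mono) auto
  finally show ?thesis .
qed

lemma abs_expectation_le_const:
  fixes f :: "'a \<Rightarrow> real"
  assumes "\<And>x. \<bar>f x\<bar> \<le> c"
  shows "\<bar>measure_pmf.expectation p f\<bar> \<le> c"
  using abs_expectation_le[of f "\<lambda>_. c" p] assms by simp

lemma expectation_stationary:
  fixes f :: "'s \<Rightarrow> real"
  assumes "bind_pmf \<pi> K = \<pi>" and "\<And>x. \<bar>f x\<bar> \<le> c"
  shows "measure_pmf.expectation \<pi> (\<lambda>s. measure_pmf.expectation (K s) f) = measure_pmf.expectation \<pi> f"
proof -
  have "measure_pmf.expectation (bind_pmf \<pi> K) f = measure_pmf.expectation \<pi> (\<lambda>s. measure_pmf.expectation (K s) f)"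
    unfolding measure_pmf_bind
    using assms(2)
    by (intro integral_bind[where K="count_space UNIV" and B=c and B'=1])
       (auto simp: measure_pmf_in_subprob_algebra measure_pmf.emeasure_space_le_1)
  with assms(1) show ?thesis by simp
qed

text \<open>\<open>taboo K a m \<phi> s\<close> is the expectation of \<open>\<phi> (S m)\<close> on the event that the return time
  to \<open>a\<close> exceeds \<open>m\<close>, for the chain started in \<open>s\<close>.\<close>

primrec taboo :: "('s \<Rightarrow> 's pmf) \<Rightarrow> 's \<Rightarrow> nat \<Rightarrow> ('s \<Rightarrow> real) \<Rightarrow> 's \<Rightarrow> real" where
  "taboo K a 0 \<phi> s = \<phi> s"
| "taboo K a (Suc m) \<phi> s =
     measure_pmf.expectation (K s) (\<lambda>s'. if s' = a then 0 else taboo K a m \<phi> s')"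

abbreviation surv :: "('s \<Rightarrow> 's pmf) \<Rightarrow> 's \<Rightarrow> nat \<Rightarrow> 's \<Rightarrow> real" where
  "surv K a m s \<equiv> taboo K a m (\<lambda>_. 1) s"

text \<open>This is the expected sum of \<open>\<phi>\<close> over the slots before the first
  positive time at \<open>a\<close>, slot 0 included. Started at \<open>a\<close> it runs over a
  full return cycle, and with \<open>\<phi> = 1\<close> it is the mean hitting or return
  time.\<close>

definition potential :: "('s \<Rightarrow> 's pmf) \<Rightarrow> 's \<Rightarrow> ('s \<Rightarrow> real) \<Rightarrow> 's \<Rightarrow> real" where
  "potential K a \<phi> s = (\<Sum>m. taboo K a m \<phi> s)"

lemma taboo_bounded:
  assumes "\<And>s. \<bar>\<phi> s\<bar> \<le> c"
  shows "\<bar>taboo K a m \<phi> s\<bar> \<le> c"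
proof (induction m arbitrary: s)
  case 0
  then show ?case using assms by simp
next
  case (Suc m)
  have "0 \<le> c" using assms[of s] by linarith
  then show ?case using Suc by (auto intro!: abs_expectation_le_const)
qed

lemma taboo_nonneg:
  assumes "\<And>s. 0 \<le> \<phi> s"
  shows "0 \<le> taboo K a m \<phi> s"
  using assms by (induction m arbitrary: s) (auto intro!: Bochner_Integration.integral_nonneg)

lemma surv_bounds: "0 \<le> surv K a m s" "surv K a m s \<le> 1"
  using taboo_nonneg[of "\<lambda>_. 1" K a m s] taboo_bounded[of "\<lambda>_. 1" 1 K a m s] by auto

lemma integrable_taboo:
  assumes "\<And>s. \<bar>\<phi> s\<bar> \<le> c"
  shows "integrable (measure_pmf p) (taboo K a m \<phi>)"
    and "integrable (measure_pmf p) (\<lambda>s'. if s' = a then 0 else taboo K a m \<phi> s')"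
proof -
  have "0 \<le> c" using assms[of undefined] by linarith
  then show "integrable (measure_pmf p) (taboo K a m \<phi>)"
    and "integrable (measure_pmf p) (\<lambda>s'. if s' = a then 0 else taboo K a m \<phi> s')"
    using taboo_bounded[of \<phi> c K a m] assms
    by (auto intro!: integrable_measure_pmf_bounded[where c=c])
qed

text \<open>Reduces every summability question about bounded \<open>\<phi>\<close> to the tail
  probabilities of the hitting time.\<close>

lemma taboo_le_surv:
  assumes "\<And>s. \<bar>\<phi> s\<bar> \<le> c"
  shows "\<bar>taboo K a m \<phi> s\<bar> \<le> c * surv K a m s"
proof (induction m arbitrary: s)
  case 0
  then show ?case using assms by simp
next
  case (Suc m)
  have "\<bar>taboo K a (Suc m) \<phi> s\<bar>
      \<le> measure_pmf.expectation (K s) (\<lambda>s'. c * (if s' = a then 0 else surv K a m s'))"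
    unfolding taboo.simps
    using Suc integrable_taboo(2)[of "\<lambda>_. 1" 1 "K s" a K m]
    by (intro abs_expectation_le) auto
  then show ?case by simp
qed

lemma taboo_diff:
  assumes "\<And>s. \<bar>\<phi> s\<bar> \<le> c" "\<And>s. \<bar>\<psi> s\<bar> \<le> d"
  shows "taboo K a m (\<lambda>s. \<phi> s - \<psi> s) s = taboo K a m \<phi> s - taboo K a m \<psi> s"
proof (induction m arbitrary: s)
  case (Suc m)
  have "taboo K a (Suc m) (\<lambda>s. \<phi> s - \<psi> s) s = measure_pmf.expectation (K s)
      (\<lambda>s'. (if s' = a then 0 else taboo K a m \<phi> s') - (if s' = a then 0 else taboo K a m \<psi> s'))"
    unfolding taboo.simps by (intro Bochner_Integration.integral_cong) (auto simp: Suc)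
  also have "\<dots> = taboo K a (Suc m) \<phi> s - taboo K a (Suc m) \<psi> s"
    unfolding taboo.simps using assms
    by (intro Bochner_Integration.integral_diff integrable_taboo(2)[where \<phi>=\<phi>] integrable_taboo(2)[where \<phi>=\<psi>])
  finally show ?case .
qed simp

lemma tail_LIMSEQ:
  fixes u :: "nat \<Rightarrow> real"
  assumes "summable u"
  shows "(\<lambda>n. \<Sum>m. if n \<le> m then u m else 0) \<longlonglongrightarrow> 0"
proof -
  have "(\<Sum>m. if n \<le> m then u m else 0) = (\<Sum>m. u (m + n))" for n
  proof -
    have "summable (\<lambda>m. if n \<le> m then u m else 0)"
      using summable_iff_shift[of "\<lambda>m. if n \<le> m then u m else 0" n] summable_ignore_initial_segment[OF assms, of n] by simp
    from suminf_split_initial_segment[OF this, of n] show ?thesis by simp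
  qed
  moreover have "(\<lambda>n. \<Sum>m. u (m + n)) \<longlonglongrightarrow> 0"
    unfolding suminf_minus_initial_segment[OF assms]
    using tendsto_diff[OF tendsto_const[of "suminf u"] summable_LIMSEQ[OF assms]] by simp
  ultimately show ?thesis by simp
qed

text \<open>The series equals E[T(T+1)]/2 for the hitting time T of \<open>a\<close>, since
  \<open>surv K a m s\<close> is P(T > m); its convergence is finiteness of the second
  moment.\<close>

locale square_integrable_hitting =
  fixes K :: "'s \<Rightarrow> 's pmf" and a :: 's
  assumes summable_surv2: "summable (\<lambda>m. real (Suc m) * surv K a m s)"
begin

lemma summable_surv: "summable (\<lambda>m. surv K a m s)"
  using summable_surv2[of s]
proof (rule summable_comparison_test'[where N=0])
  fix n
  show "norm (surv K a n s) \<le> real (Suc n) * surv K a n s"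
    using mult_right_mono[OF _ surv_bounds(1), of 1 "real (Suc n)" K a n s]
    by (simp add: surv_bounds)
qed

lemma summable_taboo:
  assumes "\<And>s. \<bar>\<phi> s\<bar> \<le> c"
  shows "summable (\<lambda>m. taboo K a m \<phi> s)"
  by (rule summable_comparison_test'[OF summable_mult[OF summable_surv, of c]])
    (use taboo_le_surv[where \<phi>=\<phi>, OF assms] in auto)

lemma potential_le:
  assumes "\<And>s. \<bar>\<phi> s\<bar> \<le> c"
  shows "\<bar>potential K a \<phi> s\<bar> \<le> c * potential K a (\<lambda>_. 1) s"
proof -
  have s: "summable (\<lambda>m. \<bar>taboo K a m \<phi> s\<bar>)"
    by (rule summable_comparison_test'[OF summable_mult[OF summable_surv, of c]])
      (use taboo_le_surv[where \<phi>=\<phi>, OF assms] in auto)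
  have "\<bar>potential K a \<phi> s\<bar> \<le> (\<Sum>m. \<bar>taboo K a m \<phi> s\<bar>)"
    unfolding potential_def by (rule summable_rabs[OF s])
  also have "\<dots> \<le> (\<Sum>m. c * surv K a m s)"
    using taboo_le_surv[where \<phi>=\<phi>, OF assms] by (intro suminf_le s summable_mult summable_surv) auto
  also have "\<dots> = c * potential K a (\<lambda>_. 1) s"
    unfolding potential_def by (rule suminf_mult[OF summable_surv])
  finally show ?thesis .
qed

lemma potential_diff:
  assumes "\<And>s. \<bar>\<phi> s\<bar> \<le> c" "\<And>s. \<bar>\<psi> s\<bar> \<le> d"
  shows "potential K a (\<lambda>s. \<phi> s - \<psi> s) s = potential K a \<phi> s - potential K a \<psi> s"
  unfolding potential_def taboo_diff[OF assms]
  using assms by (intro suminf_diff[symmetric] summable_taboo)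

text \<open>First-step analysis for weighted series, by exchanging sum and expectation. The weight
  is 1 for means, \<open>Suc m\<close> for second moments, and a truncated \<open>Suc m\<close> for
  their tails.\<close>

lemma taboo_sums:
  assumes w: "\<And>m. 0 \<le> w m" "\<And>s. summable (\<lambda>m. w m * surv K a m s)"
    and w': "summable (\<lambda>m. w m * surv K a (Suc m) s)"
    and \<phi>: "\<And>s. \<bar>\<phi> s\<bar> \<le> c"
  shows "integrable (measure_pmf (K s)) (\<lambda>s'. if s' = a then 0 else (\<Sum>m. w m * taboo K a m \<phi> s'))"
    and "(\<Sum>m. w m * taboo K a (Suc m) \<phi> s)
      = measure_pmf.expectation (K s) (\<lambda>s'. if s' = a then 0 else (\<Sum>m. w m * taboo K a m \<phi> s'))"
proof -
  let ?f = "\<lambda>m s'. w m * (if s' = a then 0 else taboo K a m \<phi> s')"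
  have c: "0 \<le> c" using \<phi>[of s] by linarith
  have le: "norm (?f m s') \<le> c * (w m * (if s' = a then 0 else surv K a m s'))" for m s'
    using mult_left_mono[OF taboo_le_surv[where \<phi>=\<phi>, OF \<phi>] w(1)[of m], of K a m s'] w(1)[of m]
    by (auto simp: abs_mult mult_ac)
  have int: "integrable (measure_pmf (K s)) (?f m)" for m
    using integrable_taboo(2)[of \<phi> c "K s" a K m] \<phi> by auto
  have s1: "summable (\<lambda>m. norm (?f m s'))" for s'
  proof (rule summable_comparison_test'[where N=0])
    show "summable (\<lambda>m. c * (w m * (if s' = a then 0 else surv K a m s')))"
      by (intro summable_mult) (use w(2)[of s'] in \<open>cases "s' = a"; simp\<close>)
  qed (use le in auto)
  \<comment> \<open>One more step turns the masked \<open>surv K a m\<close> into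
    \<open>surv K a (Suc m)\<close>, which is why summability of the shifted series is a separate
    hypothesis.\<close>
  have s2: "summable (\<lambda>m. measure_pmf.expectation (K s) (\<lambda>s'. norm (?f m s')))"
  proof (rule summable_comparison_test'[where N=0])
    show "summable (\<lambda>m. c * (w m * surv K a (Suc m) s))"
      by (intro summable_mult w')
    fix m
    have "\<bar>measure_pmf.expectation (K s) (\<lambda>s'. norm (?f m s'))\<bar>
        \<le> measure_pmf.expectation (K s) (\<lambda>s'. c * (w m * (if s' = a then 0 else surv K a m s')))"
      using le[of m] integrable_taboo(2)[of "\<lambda>_. 1" 1 "K s" a K m]
      by (intro abs_expectation_le) auto
    then show "norm (measure_pmf.expectation (K s) (\<lambda>s'. norm (?f m s'))) \<le> c * (w m * surv K a (Suc m) s)"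
      by simp
  qed
  have eq: "(\<Sum>m. ?f m s') = (if s' = a then 0 else (\<Sum>m. w m * taboo K a m \<phi> s'))" for s'
    by simp
  have "integrable (measure_pmf (K s)) (\<lambda>s'. \<Sum>m. ?f m s')"
    using int s1 s2 by (intro integrable_suminf) auto
  then show "integrable (measure_pmf (K s)) (\<lambda>s'. if s' = a then 0 else (\<Sum>m. w m * taboo K a m \<phi> s'))"
    unfolding eq .
  have "measure_pmf.expectation (K s) (\<lambda>s'. \<Sum>m. ?f m s') = (\<Sum>m. measure_pmf.expectation (K s) (?f m))"
    using int s1 s2 by (intro integral_suminf) auto
  then show "(\<Sum>m. w m * taboo K a (Suc m) \<phi> s)
      = measure_pmf.expectation (K s) (\<lambda>s'. if s' = a then 0 else (\<Sum>m. w m * taboo K a m \<phi> s'))"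
    unfolding eq by simp
qed

text \<open>The term m = 0 is split off and the rest is one step of the chain. The next state counts
  as 0 at \<open>a\<close>, so the identity holds at s = \<open>a\<close> as well, where its
  right-hand side involves the value for a whole cycle.\<close>

lemma
  assumes \<phi>: "\<And>s. \<bar>\<phi> s\<bar> \<le> c"
  shows integrable_potential:
      "integrable (measure_pmf (K s)) (\<lambda>s'. if s' = a then 0 else potential K a \<phi> s')"
    and potential_step: "measure_pmf.expectation (K s) (\<lambda>s'. if s' = a then 0 else potential K a \<phi> s')
      = potential K a \<phi> s - \<phi> s"
proof -
  have w: "summable (\<lambda>m. 1 * surv K a m s)" for s
    using summable_surv by simp
  have w': "summable (\<lambda>m. 1 * surv K a (Suc m) s)"
    using summable_Suc_iff[of "\<lambda>m. surv K a m s"] summable_surv by (simp del: taboo.simps(2))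
  note * = taboo_sums[where w="\<lambda>_. 1" and \<phi>=\<phi>, OF _ w w' \<phi>]
  show "integrable (measure_pmf (K s)) (\<lambda>s'. if s' = a then 0 else potential K a \<phi> s')"
    using *(1) by (simp add: potential_def cong: if_cong)
  have "potential K a \<phi> s = \<phi> s + (\<Sum>m. taboo K a (Suc m) \<phi> s)"
    using suminf_split_head[OF summable_taboo[where \<phi>=\<phi>, OF \<phi>], of s]
    by (simp add: potential_def del: taboo.simps(2))
  then show "measure_pmf.expectation (K s) (\<lambda>s'. if s' = a then 0 else potential K a \<phi> s')
      = potential K a \<phi> s - \<phi> s"
    using *(2) by (simp add: potential_def del: taboo.simps(2) cong: if_cong)
qed

text \<open>Stationarity makes the taboo expectations under \<open>\<pi>\<close> telescope; this avoids integrating the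
  potential itself, which need not be bounded.\<close>

lemma cycle_formula:
  assumes stat: "bind_pmf \<pi> K = \<pi>" and \<phi>: "\<And>s. \<bar>\<phi> s\<bar> \<le> c"
  shows "potential K a \<phi> a = potential K a (\<lambda>_. 1) a * measure_pmf.expectation \<pi> \<phi>"
proof -
  have *: "pmf \<pi> a * potential K a \<psi> a = measure_pmf.expectation \<pi> \<psi>" if \<psi>: "\<And>s. \<bar>\<psi> s\<bar> \<le> d" for \<psi> d
  proof -
    have d: "0 \<le> d" using \<psi>[of a] by linarith
    let ?e = "\<lambda>m. measure_pmf.expectation \<pi> (taboo K a m \<psi>)"
    \<comment> \<open>By stationarity one further taboo step only deletes the contribution of the
      state \<open>a\<close>.\<close>
    have step: "?e m - ?e (Suc m) = pmf \<pi> a * taboo K a m \<psi> a" for m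
    proof -
      have "?e (Suc m) = measure_pmf.expectation \<pi> (\<lambda>s'. if s' = a then 0 else taboo K a m \<psi> s')"
        unfolding taboo.simps using taboo_bounded[of \<psi> d K a m] \<psi> d
        by (intro expectation_stationary[OF stat, where c=d]) auto
      moreover have "?e m - \<dots> = measure_pmf.expectation \<pi>
          (\<lambda>s. taboo K a m \<psi> s - (if s = a then 0 else taboo K a m \<psi> s))"
        using integrable_taboo[of \<psi> d \<pi>] \<psi> by (intro Bochner_Integration.integral_diff[symmetric]) auto
      moreover have "\<dots> = measure_pmf.expectation \<pi> (\<lambda>s. taboo K a m \<psi> a * indicator {a} s)"
        by (intro Bochner_Integration.integral_cong) (auto simp: indicator_def)
      moreover have "\<dots> = taboo K a m \<psi> a * pmf \<pi> a"
        by (simp add: measure_pmf_single)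
      ultimately show ?thesis by simp
    qed
    \<comment> \<open>Pointwise, taboo expectations are terms of a convergent series, hence vanish
      in the limit; the constant d dominates them.\<close>
    have "(\<lambda>m. ?e m) \<longlonglongrightarrow> measure_pmf.expectation \<pi> (\<lambda>_. 0)"
    proof (rule integral_dominated_convergence[where w="\<lambda>_. d"])
      show "AE s in measure_pmf \<pi>. (\<lambda>m. taboo K a m \<psi> s) \<longlonglongrightarrow> 0"
        using summable_LIMSEQ_zero[OF summable_taboo[where \<phi>=\<psi>, OF \<psi>]] by auto
      show "AE s in measure_pmf \<pi>. norm (taboo K a m \<psi> s) \<le> d" for m
        using taboo_bounded[of \<psi> d] \<psi> by auto
    qed auto
    then have "(\<lambda>m. ?e m - ?e (Suc m)) sums (?e 0 - 0)"
      by (intro telescope_sums') simp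
    then have "(\<lambda>m. pmf \<pi> a * taboo K a m \<psi> a) sums measure_pmf.expectation \<pi> \<psi>"
      unfolding step by (simp add: taboo.simps(1)[abs_def])
    moreover have "(\<lambda>m. pmf \<pi> a * taboo K a m \<psi> a) sums (pmf \<pi> a * potential K a \<psi> a)"
      unfolding potential_def by (intro sums_mult summable_sums summable_taboo[where \<phi>=\<psi>, OF \<psi>])
    ultimately show ?thesis by (rule sums_unique2[symmetric])
  qed
  \<comment> \<open>Kac's formula: the stationary mass of \<open>a\<close> is the reciprocal of its
    mean return time. It eliminates the mass from the general identity.\<close>
  have "pmf \<pi> a * potential K a (\<lambda>_. 1) a = 1"
    using *[of "\<lambda>_. 1" 1] by simp
  then show ?thesis
    using *[of \<phi> c] \<phi> by (metis mult.assoc mult.commute mult_1)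
qed

text \<open>The value 0 at \<open>a\<close>, instead of the mean return time, makes one-step
  expectations plain expectations of \<open>hit1\<close>; the discrepancy reappears as a source term
  at \<open>a\<close>.\<close>

definition hit1 :: "'s \<Rightarrow> real" where
  "hit1 s = (if s = a then 0 else potential K a (\<lambda>_. 1) s)"

text \<open>Off \<open>a\<close> this is E[T(T+1)]/2. This normalisation makes its one-step decrease
  off \<open>a\<close> exactly \<open>hit1\<close>.\<close>

definition hit2 :: "'s \<Rightarrow> real" where
  "hit2 s = (if s = a then 0 else (\<Sum>m. real (Suc m) * surv K a m s))"

definition hit2_tail :: "nat \<Rightarrow> 's \<Rightarrow> real" where
  "hit2_tail n s = (if s = a then 0 else (\<Sum>m. (if n \<le> m then real (Suc m) else 0) * surv K a m s))"

lemma integrable_hit1: "integrable (measure_pmf (K s)) hit1"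
  and expectation_hit1: "measure_pmf.expectation (K s) hit1 = potential K a (\<lambda>_. 1) s - 1"
  using integrable_potential[of "\<lambda>_. 1" 1 s] potential_step[of "\<lambda>_. 1" 1 s]
  by (simp_all add: hit1_def[abs_def])

lemma summable_surv2_shift: "summable (\<lambda>m. real (Suc m) * surv K a (Suc m) s)"
proof (rule summable_comparison_test'[where N=0])
  show "summable (\<lambda>m. real (Suc (Suc m)) * surv K a (Suc m) s)"
    using summable_Suc_iff[of "\<lambda>m. real (Suc m) * surv K a m s"] summable_surv2 by blast
  show "norm (real (Suc m) * surv K a (Suc m) s) \<le> real (Suc (Suc m)) * surv K a (Suc m) s" for m
    using surv_bounds(1)[of K a "Suc m" s] by (simp add: mult_right_mono del: taboo.simps(2))
qed

text \<open>After the step the series is (m+1) P(T > m+1), which reindexes to m P(T > m) because the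
  new term at m = 0 vanishes; subtracting leaves one copy of the mean.\<close>

lemma integrable_hit2: "integrable (measure_pmf (K s)) hit2"
  and expectation_hit2: "measure_pmf.expectation (K s) hit2
    = (\<Sum>m. real (Suc m) * surv K a m s) - potential K a (\<lambda>_. 1) s"
proof -
  note * = taboo_sums[where w="\<lambda>m. real (Suc m)" and \<phi>="\<lambda>_. 1" and c=1,
      OF _ summable_surv2 summable_surv2_shift, folded hit2_def[abs_def]]
  show "integrable (measure_pmf (K s)) hit2"
    using *(1)[of s] by (simp add: hit2_def[abs_def])
  have "(\<Sum>m. real (Suc m) * surv K a (Suc m) s) = (\<Sum>m. real m * surv K a m s)"
  proof -
    have "summable (\<lambda>m. real m * surv K a m s)"
      using summable_Suc_iff[of "\<lambda>m. real m * surv K a m s"] summable_surv2_shift by blast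
    from suminf_split_head[OF this] show ?thesis by simp
  qed
  also have "\<dots> = (\<Sum>m. real (Suc m) * surv K a m s - surv K a m s)"
    by (simp add: algebra_simps)
  also have "\<dots> = (\<Sum>m. real (Suc m) * surv K a m s) - potential K a (\<lambda>_. 1) s"
    unfolding potential_def using summable_surv2 summable_surv by (intro suminf_diff[symmetric])
  finally show "measure_pmf.expectation (K s) hit2
    = (\<Sum>m. real (Suc m) * surv K a m s) - potential K a (\<lambda>_. 1) s"
    using *(2)[of s] by (simp add: hit2_def[abs_def] del: taboo.simps(2))
qed

lemma summable_tail:
  assumes "summable (\<lambda>m. real (Suc m) * surv K a (f m) s)"
  shows "summable (\<lambda>m. (if n \<le> m then real (Suc m) else 0) * surv K a (f m) s)"
proof (rule summable_comparison_test'[OF assms])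
  fix m
  show "norm ((if n \<le> m then real (Suc m) else 0) * surv K a (f m) s) \<le> real (Suc m) * surv K a (f m) s"
    using surv_bounds(1)[of K a "f m" s] by simp
qed

lemma integrable_hit2_tail: "integrable (measure_pmf (K s)) (hit2_tail n)"
  and expectation_hit2_tail: "measure_pmf.expectation (K s) (hit2_tail n)
    = (\<Sum>m. (if n \<le> m then real (Suc m) else 0) * surv K a (Suc m) s)"
proof -
  note * = taboo_sums[where w="\<lambda>m. if n \<le> m then real (Suc m) else 0" and \<phi>="\<lambda>_. 1" and c=1 and s=s,
      OF _ summable_tail[OF summable_surv2] summable_tail[OF summable_surv2_shift]]
  show "integrable (measure_pmf (K s)) (hit2_tail n)"
    using *(1) by (simp add: hit2_tail_def[abs_def])
  show "measure_pmf.expectation (K s) (hit2_tail n)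
    = (\<Sum>m. (if n \<le> m then real (Suc m) else 0) * surv K a (Suc m) s)"
    using *(2) by (simp add: hit2_tail_def[abs_def] del: taboo.simps(2))
qed

lemma hit2_tail_nonneg: "0 \<le> hit2_tail n s"
  unfolding hit2_tail_def
  using surv_bounds(1)[of K a] by (auto intro!: suminf_nonneg summable_tail[OF summable_surv2])

lemma hit2_tail_le: "hit2_tail n s \<le> hit2 s"
  unfolding hit2_tail_def hit2_def
  using surv_bounds(1)[of K a]
  by (auto intro!: suminf_le summable_tail[OF summable_surv2] summable_surv2 mult_right_mono simp del: of_nat_Suc)

text \<open>A step shifts the survival probabilities by one against the weights, and the weights
  \<open>?w\<close> are nondecreasing. So the truncated series is a supermartingale away from
  \<open>a\<close>.\<close>

lemma expectation_hit2_tail_le: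
  assumes "s \<noteq> a"
  shows "measure_pmf.expectation (K s) (hit2_tail n) \<le> hit2_tail n s"
proof -
  let ?w = "\<lambda>m. if n \<le> m then real (Suc m) else 0"
  have s: "summable (\<lambda>m. ?w m * surv K a m s)"
    by (rule summable_tail[OF summable_surv2])
  then have s': "summable (\<lambda>m. ?w (Suc m) * surv K a (Suc m) s)"
    using summable_Suc_iff[of "\<lambda>m. ?w m * surv K a m s"] by blast
  have "(\<Sum>m. ?w m * surv K a (Suc m) s) \<le> (\<Sum>m. ?w (Suc m) * surv K a (Suc m) s)"
    using surv_bounds(1)[of K a]
    by (intro suminf_le s' summable_tail[OF summable_surv2_shift] mult_right_mono) auto
  also have "\<dots> \<le> (\<Sum>m. ?w m * surv K a m s)"
    using suminf_split_head[OF s] surv_bounds(1)[of K a 0 s] by simp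
  finally show ?thesis
    using assms by (simp add: expectation_hit2_tail hit2_tail_def del: taboo.simps(2))
qed

lemma expectation_hit2_tail_LIMSEQ:
  "(\<lambda>n. measure_pmf.expectation (K s) (hit2_tail n)) \<longlonglongrightarrow> 0"
proof -
  have "(if n \<le> m then real (Suc m) else 0) * surv K a (Suc m) s
     = (if n \<le> m then real (Suc m) * surv K a (Suc m) s else 0)" for n m by simp
  then show ?thesis
    unfolding expectation_hit2_tail using tail_LIMSEQ[OF summable_surv2_shift[of s]] by presburger
qed

text \<open>The n discarded terms are each at most n, since survival probabilities are at most
  1.\<close>

lemma hit2_le_tail: "hit2 s \<le> real n * real n + hit2_tail n s"
proof (cases "s = a")
  case False
  let ?w = "\<lambda>m. if n \<le> m then real (Suc m) else 0"
  let ?v = "\<lambda>m. if m \<in> {..<n} then real n else 0"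
  have v: "?v sums (\<Sum>m<n. real n)" by (rule sums_If_finite_set) simp
  have "(\<Sum>m. real (Suc m) * surv K a m s) \<le> (\<Sum>m. ?v m + ?w m * surv K a m s)"
  proof (intro suminf_le summable_surv2 summable_add summable_tail[OF summable_surv2] sums_summable[OF v])
    fix m
    show "real (Suc m) * surv K a m s \<le> ?v m + ?w m * surv K a m s"
      using mult_mono[of "real (Suc m)" "real n" "surv K a m s" 1] surv_bounds[of K a m s] by auto
  qed
  also have "\<dots> = suminf ?v + (\<Sum>m. ?w m * surv K a m s)"
    by (intro suminf_add[symmetric] sums_summable[OF v] summable_tail[OF summable_surv2])
  also have "suminf ?v = real n * real n" using sums_unique[OF v] by simp
  finally show ?thesis using False by (simp add: hit2_def hit2_tail_def)
qed (simp add: hit2_def hit2_tail_def)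

lemma hit1_nonneg: "0 \<le> hit1 s"
  unfolding hit1_def potential_def using surv_bounds(1)[of K a] by (auto intro!: suminf_nonneg summable_surv)

lemma hit1_le_hit2: "hit1 s \<le> hit2 s"
proof -
  have "surv K a m s \<le> real (Suc m) * surv K a m s" for m
    using mult_right_mono[of 1 "real (Suc m)" "surv K a m s"] surv_bounds(1)[of K a m s] by simp
  then have "(\<Sum>m. surv K a m s) \<le> (\<Sum>m. real (Suc m) * surv K a m s)"
    by (intro suminf_le summable_surv summable_surv2)
  then show ?thesis by (simp add: hit1_def hit2_def potential_def)
qed

text \<open>This is (E T)^2 <= E[T(T+1)], shown on partial sums: with 0 <= p <= 1 the new cross term
  is at most 2 n p_n and p_n^2 <= p_n.\<close>

lemma hit1_square_le: "(hit1 s)\<^sup>2 \<le> 2 * hit2 s"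
proof (cases "s = a")
  case False
  let ?p = "\<lambda>m. surv K a m s"
  have fin: "(\<Sum>m<n. ?p m)\<^sup>2 \<le> 2 * (\<Sum>m<n. real (Suc m) * ?p m)" for n
  proof (induction n)
    case (Suc n)
    have le: "(\<Sum>m<n. ?p m) \<le> real n"
      using sum_mono[of "{..<n}" ?p "\<lambda>_. 1"] surv_bounds(2)[of K a] by simp
    have "(\<Sum>m<Suc n. ?p m)\<^sup>2 = (\<Sum>m<n. ?p m)\<^sup>2 + 2 * ((\<Sum>m<n. ?p m) * ?p n) + ?p n * ?p n"
      by (simp add: power2_eq_square algebra_simps)
    also have "\<dots> \<le> 2 * (\<Sum>m<n. real (Suc m) * ?p m) + 2 * (real n * ?p n) + 1 * ?p n"
      using le surv_bounds[of K a n s] by (intro add_mono Suc mult_left_mono mult_right_mono) auto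
    also have "\<dots> \<le> 2 * (\<Sum>m<Suc n. real (Suc m) * ?p m)"
      using surv_bounds[of K a n s] by (simp add: algebra_simps)
    finally show ?case .
  qed simp
  have "(\<lambda>n. (\<Sum>m<n. ?p m)\<^sup>2) \<longlonglongrightarrow> (hit1 s)\<^sup>2"
    using False unfolding hit1_def potential_def by (auto intro!: tendsto_power summable_LIMSEQ summable_surv)
  moreover have "(\<lambda>n. 2 * (\<Sum>m<n. real (Suc m) * ?p m)) \<longlonglongrightarrow> 2 * hit2 s"
    using False unfolding hit2_def by (auto intro!: tendsto_mult summable_LIMSEQ summable_surv2 simp del: of_nat_Suc)
  ultimately show ?thesis
    using fin by (intro LIMSEQ_le[where X="\<lambda>n. (\<Sum>m<n. ?p m)\<^sup>2"]) blast+
qed (simp add: hit1_def hit2_def)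

lemma return_time_ge_1: "1 \<le> potential K a (\<lambda>_. 1) s"
  using expectation_hit1[of s] Bochner_Integration.integral_nonneg[of "measure_pmf (K s)" hit1] hit1_nonneg by simp

end

section \<open>Moments of the hitting time\<close>

lemma sets_chain_law:
  fixes K :: "'s::countable \<Rightarrow> 's pmf"
  shows "sets (chain_law K s) = sets (PiM UNIV (\<lambda>_. count_space UNIV))"
proof -
  interpret IT: Ionescu_Tulcea "chain_step K s" "\<lambda>_. count_space UNIV"
    by (rule Ionescu_Tulcea_chain_step)
  show ?thesis unfolding chain_law_def by (rule IT.PF.sets_lim)
qed

lemma measurable_chain_law_component [measurable]:
  fixes K :: "'s::countable \<Rightarrow> 's pmf"
  shows "(\<lambda>\<omega>. \<omega> i) \<in> measurable (chain_law K s) (count_space UNIV)"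
  unfolding measurable_cong_sets[OF sets_chain_law refl] by (rule measurable_component_singleton) simp

lemma space_chain_law [simp]:
  fixes K :: "'s::countable \<Rightarrow> 's pmf"
  shows "space (chain_law K s) = UNIV"
  using sets_eq_imp_space_eq[OF sets_chain_law[of K s]] by (simp add: space_PiM PiE_UNIV_domain)

lemma sets_chain_law_finite:
  fixes K :: "'s::countable \<Rightarrow> 's pmf"
  assumes "finite I"
  shows "{\<omega>. \<forall>i\<in>I. \<omega> i \<in> A i} \<in> sets (chain_law K s)"
  using assms
proof (induction I)
  case empty
  then show ?case using sets.top[of "chain_law K s"] by simp
next
  case (insert i I)
  have "{\<omega>. \<forall>i\<in>insert i I. \<omega> i \<in> A i} = ((\<lambda>\<omega>. \<omega> i) -` A i \<inter> space (chain_law K s)) \<inter> {\<omega>. \<forall>i\<in>I. \<omega> i \<in> A i}"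
    by auto
  then show ?case
    using insert measurable_sets[OF measurable_chain_law_component, of "A i" i] by auto
qed

lemma sets_chain_law_avoid:
  fixes K :: "'s::countable \<Rightarrow> 's pmf"
  shows "{\<omega>. \<forall>i\<in>{n<..m}. \<omega> i \<noteq> a} \<in> sets (chain_law K s)"
    and "{\<omega>. (\<forall>i\<le>k. \<omega> i = p i) \<and> (\<forall>i\<in>{n<..m}. \<omega> i \<noteq> a)} \<in> sets (chain_law K s)"
proof -
  show 1: "{\<omega>. \<forall>i\<in>{n<..m}. \<omega> i \<noteq> a} \<in> sets (chain_law K s)"
    using sets_chain_law_finite[of "{n<..m}" "\<lambda>_. -{a}" K s] by simp
  have "{\<omega>. (\<forall>i\<le>k. \<omega> i = p i) \<and> (\<forall>i\<in>{n<..m}. \<omega> i \<noteq> a)}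
      = {\<omega>. \<forall>i\<in>{..k}. \<omega> i \<in> {p i}} \<inter> {\<omega>. \<forall>i\<in>{n<..m}. \<omega> i \<noteq> a}"
    by auto
  then show "{\<omega>. (\<forall>i\<le>k. \<omega> i = p i) \<and> (\<forall>i\<in>{n<..m}. \<omega> i \<noteq> a)} \<in> sets (chain_law K s)"
    using sets.Int[OF sets_chain_law_finite[of "{..k}" "\<lambda>i. {p i}" K s] 1] by (metis finite_atMost)
qed

text \<open>The Markov property at time n, derived from cylinder probabilities alone. The event
  splits over the state s' at time n+1, and each piece is the same kind of event for the cylinder
  prolonged by s'; hence the induction must generalise n and p.\<close>

lemma emeasure_chain_law_avoid:
  fixes K :: "'s::countable \<Rightarrow> 's pmf"
  shows "emeasure (chain_law K s) {\<omega>. (\<forall>i\<le>n. \<omega> i = p i) \<and> (\<forall>i\<in>{n<..n+m}. \<omega> i \<noteq> a)}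
    = emeasure (chain_law K s) {\<omega>. \<forall>i\<le>n. \<omega> i = p i} * ennreal (surv K a m (p n))"
proof (induction m arbitrary: n p)
  case 0
  then show ?case by simp
next
  case (Suc m)
  let ?P = "chain_law K s"
  let ?A = "\<lambda>s'. {\<omega>. (\<forall>i\<le>Suc n. \<omega> i = (p(Suc n := s')) i) \<and> (\<forall>i\<in>{Suc n<..Suc n+m}. \<omega> i \<noteq> a)}"
  have un: "{\<omega>. (\<forall>i\<le>n. \<omega> i = p i) \<and> (\<forall>i\<in>{n<..n+Suc m}. \<omega> i \<noteq> a)} = (\<Union>s'\<in>-{a}. ?A s')"
  proof (intro set_eqI iffI)
    fix \<omega> assume \<omega>: "\<omega> \<in> {\<omega>. (\<forall>i\<le>n. \<omega> i = p i) \<and> (\<forall>i\<in>{n<..n+Suc m}. \<omega> i \<noteq> a)}"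
    then have "\<omega> \<in> ?A (\<omega> (Suc n))" by (auto simp: le_Suc_eq)
    moreover have "\<omega> (Suc n) \<noteq> a" using \<omega> by auto
    ultimately show "\<omega> \<in> (\<Union>s'\<in>-{a}. ?A s')" by blast
  next
    fix \<omega> assume "\<omega> \<in> (\<Union>s'\<in>-{a}. ?A s')"
    then obtain s' where s': "s' \<noteq> a" and \<omega>: "\<omega> \<in> ?A s'" by blast
    have "\<omega> i \<noteq> a" if "i \<in> {n<..n+Suc m}" for i
      using \<omega> s' that by (cases "i = Suc n") auto
    moreover have "\<omega> i = p i" if "i \<le> n" for i
      using \<omega> that by auto
    ultimately show "\<omega> \<in> {\<omega>. (\<forall>i\<le>n. \<omega> i = p i) \<and> (\<forall>i\<in>{n<..n+Suc m}. \<omega> i \<noteq> a)}" by blast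
  qed
  have "emeasure ?P (\<Union>s'\<in>-{a}. ?A s') = (\<integral>\<^sup>+s'. emeasure ?P (?A s') \<partial>count_space (-{a}))"
  proof (rule emeasure_UN_countable)
    show "?A s' \<in> sets ?P" for s'
      by (rule sets_chain_law_avoid)
    show "disjoint_family_on ?A (- {a})"
      unfolding disjoint_family_on_def
    proof (intro ballI impI equals0I)
      fix s1 s2 \<omega> assume "s1 \<noteq> s2" "\<omega> \<in> ?A s1 \<inter> ?A s2"
      then show False by (metis (mono_tags, lifting) IntD1 IntD2 fun_upd_same mem_Collect_eq order_refl)
    qed
  qed auto
  also have "\<dots> = (\<integral>\<^sup>+s'. emeasure ?P {\<omega>. \<forall>i\<le>n. \<omega> i = p i} * ennreal (pmf (K (p n)) s')
        * ennreal (surv K a m s') \<partial>count_space (-{a}))"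
  proof (rule nn_integral_cong)
    fix s'
    have "emeasure ?P {\<omega>. \<forall>i\<le>Suc n. \<omega> i = (p(Suc n := s')) i}
        = emeasure ?P {\<omega>. \<forall>i\<le>n. \<omega> i = p i} * ennreal (pmf (K (p n)) s')"
      unfolding emeasure_chain_law_cylinder by simp
    then show "emeasure ?P (?A s') = emeasure ?P {\<omega>. \<forall>i\<le>n. \<omega> i = p i} * ennreal (pmf (K (p n)) s')
        * ennreal (surv K a m s')"
      unfolding Suc.IH by simp
  qed
  also have "\<dots> = emeasure ?P {\<omega>. \<forall>i\<le>n. \<omega> i = p i} *
      (\<integral>\<^sup>+s'. ennreal (pmf (K (p n)) s') * ennreal (surv K a m s') \<partial>count_space (-{a}))"
    by (simp add: nn_integral_cmult mult.assoc)
  also have "(\<integral>\<^sup>+s'. ennreal (pmf (K (p n)) s') * ennreal (surv K a m s') \<partial>count_space (-{a}))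
     = (\<integral>\<^sup>+s'. ennreal (if s' = a then 0 else surv K a m s') \<partial>measure_pmf (K (p n)))"
    by (subst nn_integral_count_space_indicator)
      (auto simp: nn_integral_measure_pmf indicator_def intro!: nn_integral_cong)
  also have "\<dots> = ennreal (surv K a (Suc m) (p n))"
    unfolding taboo.simps using integrable_taboo(2)[of "\<lambda>_. 1" 1 "K (p n)" a K m] surv_bounds(1)[of K a m]
    by (intro nn_integral_eq_integral) auto
  finally show ?case unfolding un .
qed

lemma emeasure_chain_law_surv:
  fixes K :: "'s::countable \<Rightarrow> 's pmf"
  shows "emeasure (chain_law K s) {\<omega>. \<forall>i\<in>{0<..m}. \<omega> i \<noteq> a} = ennreal (surv K a m s)"
proof -
  interpret prob_space "chain_law K s" by (rule prob_space_chain_law)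
  have 0: "emeasure (chain_law K s) {\<omega>. \<omega> 0 = s} = 1"
    using emeasure_chain_law_cylinder[of K s 0 "\<lambda>_. s"] by simp
  have "AE \<omega> in chain_law K s. \<omega> 0 = s"
  proof (rule AE_I_eq_1)
    show "{\<omega> \<in> space (chain_law K s). \<omega> 0 = s} \<in> events" by measurable
  qed (simp add: 0)
  then have "emeasure (chain_law K s) {\<omega>. \<forall>i\<in>{0<..m}. \<omega> i \<noteq> a}
     = emeasure (chain_law K s) {\<omega>. (\<forall>i\<le>0. \<omega> i = s) \<and> (\<forall>i\<in>{0<..0+m}. \<omega> i \<noteq> a)}"
  proof (intro emeasure_eq_AE)
    show "{\<omega>. \<forall>i\<in>{0<..m}. \<omega> i \<noteq> a} \<in> events"
      by (rule sets_chain_law_avoid)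
    show "{\<omega>. (\<forall>i\<le>0. \<omega> i = s) \<and> (\<forall>i\<in>{0<..0+m}. \<omega> i \<noteq> a)} \<in> events"
      by (rule sets_chain_law_avoid)
  qed auto
  also have "\<dots> = ennreal (surv K a m s)"
    using emeasure_chain_law_avoid[of K s 0 "\<lambda>_. s" m a] 0 by simp
  finally show ?thesis .
qed

text \<open>Layer-cake formula: T^p is the sum of (m+1)^p - m^p over all m < T, and T > m means that
  \<open>a\<close> is avoided at times 1 to m. The case of an infinite T is included.\<close>

lemma hitting_moment_eq_suminf:
  fixes K :: "'s::countable \<Rightarrow> 's pmf"
  assumes p: "0 < p"
  shows "hitting_moment K p s a = (\<Sum>m. ennreal (real ((Suc m) ^ p - m ^ p) * surv K a m s))"
proof -
  have pw: "hitting_time a \<omega> ^ p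
    = (\<Sum>m. ennreal (real ((Suc m) ^ p - m ^ p)) * indicator {\<omega>. \<forall>i\<in>{0<..m}. \<omega> i \<noteq> a} \<omega>)" for \<omega> :: "nat \<Rightarrow> 's"
  proof -
    define u where "u m = real ((Suc m) ^ p - m ^ p)" for m
    \<comment> \<open>The subtraction on naturals is exact because powers are monotone.\<close>
    have u: "u m = real (Suc m) ^ p - real m ^ p" for m
      unfolding u_def by (simp add: of_nat_diff power_mono del: of_nat_Suc)
    have tel: "(\<Sum>m<n. ennreal (u m)) = ennreal (real n ^ p)" for n
    proof -
      have "(\<Sum>m<n. ennreal (u m)) = ennreal (\<Sum>m<n. u m)"
        by (rule sum_ennreal) (simp add: u_def)
      also have "(\<Sum>m<n. u m) = real n ^ p"
        unfolding u sum_lessThan_telescope[of "\<lambda>m. real m ^ p"] using p by simp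
      finally show ?thesis .
    qed
    let ?X = "{n. 0 < n \<and> \<omega> n = a}"
    show ?thesis
    proof (cases "?X = {}")
      case True
      then have "\<omega> i \<noteq> a" if "0 < i" for i
        using that by blast
      then have "indicator {\<omega>. \<forall>i\<in>{0<..m}. \<omega> i \<noteq> a} \<omega> = (1::ennreal)" for m
        by (simp add: indicator_def)
      \<comment> \<open>If \<open>a\<close> is never hit all indicators are 1, and the partial sums
        n^p, which are at least n as p > 0, diverge as they must.\<close>
      moreover have "(\<Sum>m. ennreal (u m)) = \<top>"
      proof -
        have "ennreal (real n) \<le> (\<Sum>m. ennreal (u m))" for n
        proof -
          have "ennreal (real n) \<le> ennreal (real n ^ p)"
            using p by (intro ennreal_leI, cases n) (auto intro!: self_le_power)
          also have "\<dots> \<le> (\<Sum>m. ennreal (u m))"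
            unfolding tel[symmetric] by (rule sum_le_suminf) auto
          finally show ?thesis .
        qed
        then show ?thesis
          using ennreal_Ex_less_of_nat[of "\<Sum>m. ennreal (u m)"]
          by (metis ennreal_of_nat_eq_real_of_nat leD top.not_eq_extremum)
      qed
      moreover have "hitting_time a \<omega> = \<top>"
        unfolding hitting_time_def True by simp
      ultimately show ?thesis
        using p by (simp add: u_def[symmetric] power_top_ennreal)
    next
      case False
      define n where "n = (LEAST n. 0 < n \<and> \<omega> n = a)"
      have n: "0 < n" "\<omega> n = a"
        using LeastI_ex[of "\<lambda>n. 0 < n \<and> \<omega> n = a"] False unfolding n_def by auto
      have least: "n \<le> k" if "0 < k" "\<omega> k = a" for k
        unfolding n_def using that by (intro Least_le) simp
      have "hitting_time a \<omega> = of_nat n"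
        unfolding hitting_time_def
      proof (rule antisym)
        show "(INF n\<in>?X. of_nat n) \<le> (of_nat n::ennreal)" using n by (intro INF_lower) simp
        show "(of_nat n::ennreal) \<le> (INF n\<in>?X. of_nat n)" using least by (intro INF_greatest) simp
      qed
      moreover have "indicator {\<omega>. \<forall>i\<in>{0<..m}. \<omega> i \<noteq> a} \<omega> = (if m < n then 1 else 0 :: ennreal)" for m
      proof -
        have "(\<forall>i\<in>{0<..m}. \<omega> i \<noteq> a) \<longleftrightarrow> m < n"
          using n least by (metis greaterThanAtMost_iff leD leI le_trans)
        then show ?thesis by simp
      qed
      moreover have "(\<Sum>m. ennreal (u m) * (if m < n then 1 else 0)) = (\<Sum>m<n. ennreal (u m))"
        by (subst suminf_finite[where N="{..<n}"]) auto
      ultimately show ?thesis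
        by (simp add: u_def[symmetric] tel ennreal_of_nat_eq_real_of_nat ennreal_power)
    qed
  qed
  have [measurable]: "{\<omega>. \<forall>i\<in>{0<..m}. \<omega> i \<noteq> a} \<in> sets (chain_law K s)" for m
    by (rule sets_chain_law_avoid)
  show ?thesis
    unfolding hitting_moment_def pw
    by (subst nn_integral_suminf)
      (auto simp: nn_integral_cmult emeasure_chain_law_surv ennreal_mult surv_bounds(1) del: ennreal_mult'')
qed

lemma square_integrable_hittingI:
  fixes K :: "'s::countable \<Rightarrow> 's pmf"
  assumes "\<And>s. hitting_moment K 2 s a < \<infinity>"
  shows "square_integrable_hitting K a"
proof
  fix s
  have sq: "(Suc m)\<^sup>2 - m\<^sup>2 = 2 * m + 1" for m
    by (simp add: power2_eq_square)
  have "(\<Sum>m. ennreal (real (2 * m + 1) * surv K a m s)) \<noteq> \<top>"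
    using assms[of s] hitting_moment_eq_suminf[of 2 K s a] by (simp add: sq)
  then have "summable (\<lambda>m. real (2 * m + 1) * surv K a m s)"
    by (intro summable_suminf_not_top) (auto simp: surv_bounds(1))
  then show "summable (\<lambda>m. real (Suc m) * surv K a m s)"
  proof (rule summable_comparison_test'[where N=0])
    show "norm (real (Suc m) * surv K a m s) \<le> real (2 * m + 1) * surv K a m s" for m
      using surv_bounds(1)[of K a m s] by (simp add: mult_right_mono)
  qed
qed

lemma hitting_moment_1:
  fixes K :: "'s::countable \<Rightarrow> 's pmf"
  assumes "square_integrable_hitting K a"
  shows "enn2real (hitting_moment K 1 s a) = potential K a (\<lambda>_. 1) s"
proof -
  interpret square_integrable_hitting K a by fact
  have "hitting_moment K 1 s a = (\<Sum>m. ennreal (surv K a m s))"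
    by (simp add: hitting_moment_eq_suminf)
  also have "\<dots> = ennreal (\<Sum>m. surv K a m s)"
    using summable_surv surv_bounds(1) by (intro suminf_ennreal2) auto
  finally show ?thesis
    using return_time_ge_1[of s] by (simp add: potential_def)
qed

text \<open>The weights (m+1)^2 - m^2 equal 2(m+1) - 1, which separates the second moment into the
  two series used for \<open>hit2\<close> and \<open>hit1\<close>.\<close>

lemma hitting_moment_2:
  fixes K :: "'s::countable \<Rightarrow> 's pmf"
  assumes "square_integrable_hitting K a"
  shows "enn2real (hitting_moment K 2 s a)
    = 2 * (\<Sum>m. real (Suc m) * surv K a m s) - potential K a (\<lambda>_. 1) s"
proof -
  interpret square_integrable_hitting K a by fact
  have sq: "real ((Suc m)\<^sup>2 - m\<^sup>2) = 2 * real (Suc m) - 1" for m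
    by (simp add: power2_eq_square)
  have s: "(\<lambda>m. 2 * (real (Suc m) * surv K a m s) - surv K a m s) sums
      (2 * (\<Sum>m. real (Suc m) * surv K a m s) - potential K a (\<lambda>_. 1) s)"
    unfolding potential_def
    by (intro sums_diff sums_mult summable_sums summable_surv2 summable_surv)
  have nn: "0 \<le> 2 * (real (Suc m) * surv K a m s) - surv K a m s" for m
    using surv_bounds(1)[of K a m s] by (simp add: algebra_simps)
  have "hitting_moment K 2 s a = (\<Sum>m. ennreal (2 * (real (Suc m) * surv K a m s) - surv K a m s))"
    unfolding hitting_moment_eq_suminf[OF zero_less_numeral] sq by (simp add: algebra_simps del: of_nat_Suc)
  also have "\<dots> = ennreal (\<Sum>m. 2 * (real (Suc m) * surv K a m s) - surv K a m s)"
    using nn s by (intro suminf_ennreal2) (auto simp: sums_iff)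
  finally show ?thesis
    using sums_unique[OF s] suminf_nonneg[OF sums_summable[OF s] nn] by simp
qed

section \<open>Conditioning on the next state\<close>

text \<open>Infima over uncountable action sets carry no measurability by themselves. Here it comes
  from continuity in the product topology, because only the coordinates in J matter and matter in a
  Lipschitz way.\<close>

lemma borel_measurable_coordinate_Lipschitz:
  fixes f :: "(nat \<Rightarrow> real) \<Rightarrow> real"
  assumes "\<And>q q'. \<bar>f q - f q'\<bar> \<le> c * (\<Sum>j\<in>J. \<bar>q j - q' j\<bar>)"
  shows "f \<in> borel_measurable borel"
proof (rule borel_measurable_continuous_onI, unfold continuous_on_eq_continuous_at[OF open_UNIV], intro ballI)
  fix q :: "nat \<Rightarrow> real"
  have coord: "((\<lambda>q'. q' j) \<longlongrightarrow> q j) (at q)" for j :: nat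
  proof -
    have "isCont (\<lambda>q'::nat \<Rightarrow> real. q' j) q"
      using continuous_on_product_coordinates by (rule continuous_on_interior) simp
    then show ?thesis by (simp add: isCont_def)
  qed
  have "((\<lambda>q'. c * (\<Sum>j\<in>J. \<bar>q' j - q j\<bar>)) \<longlongrightarrow> c * (\<Sum>j\<in>J. \<bar>q j - q j\<bar>)) (at q)"
    by (intro tendsto_intros coord)
  then have "((\<lambda>q'. c * (\<Sum>j\<in>J. \<bar>q' j - q j\<bar>)) \<longlongrightarrow> 0) (at q)"
    by simp
  then have "((\<lambda>q'. f q' - f q) \<longlongrightarrow> 0) (at q)"
    by (rule Lim_null_comparison[OF always_eventually, rotated]) (simp add: assms)
  then show "isCont f q"
    unfolding isCont_def by (rule LIM_zero_cancel)
qed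

lemma (in feasible_policy) S_measurable [measurable]: "S t \<in> measurable M (count_space UNIV)"
  by (rule measurable_from_subalg[OF sub_algebra S_adapted])

lemma (in feasible_policy) measurable_F_mono:
  assumes "f \<in> measurable (F s) L" "s \<le> t"
  shows "f \<in> measurable (F t) L"
  using assms sets_F_mono[OF assms(2)] space_F by (auto simp: measurable_def)

text \<open>The Markov property, given as a real conditional expectation, is transferred to the
  nonnegative one by comparing integrals over sets of \<open>F t\<close>; then the factor u can be
  pulled out without any integrability.\<close>

lemma (in feasible_policy) nn_integral_next_state_single:
  assumes u: "u \<in> borel_measurable (F t)"
  shows "(\<integral>\<^sup>+\<omega>. u \<omega> * indicator {s} (S (Suc t) \<omega>) \<partial>M) = (\<integral>\<^sup>+\<omega>. u \<omega> * ennreal (pmf (kernel N (S t \<omega>)) s) \<partial>M)"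
proof -
  interpret sub: finite_measure_subalgebra M "F t"
    by unfold_locales (rule sub_algebra)
  let ?f = "\<lambda>\<omega>. indicator {\<omega>\<in>space M. S (Suc t) \<omega> = s} \<omega> :: real"
  let ?g = "\<lambda>\<omega>. pmf (kernel N (S t \<omega>)) s"
  have f [measurable]: "?f \<in> borel_measurable M" by measurable
  have gF [measurable]: "?g \<in> borel_measurable (F t)"
    by (rule measurable_compose[OF S_adapted]) simp
  have g [measurable]: "?g \<in> borel_measurable M"
    by (rule measurable_from_subalg[OF sub_algebra gF])
  have fi: "integrable M ?f" by (rule integrable_const_bound[where B=1]) auto
  have gi: "integrable M ?g" by (rule integrable_const_bound[where B=1]) (auto simp: pmf_le_1)
  have "AE \<omega> in M. ennreal (?g \<omega>) = nn_cond_exp M (F t) (\<lambda>\<omega>. ennreal (?f \<omega>)) \<omega>"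
  proof (rule sub.nn_cond_exp_charact)
    fix A assume A: "A \<in> sets (F t)"
    then have AM: "A \<in> sets M" using sub_algebra by (auto simp: subalgebra_def)
    have "(\<integral>\<^sup>+\<omega>. ennreal (?f \<omega>) * indicator A \<omega> \<partial>M) = (\<integral>\<^sup>+\<omega>. ennreal (indicator A \<omega> * ?f \<omega>) \<partial>M)"
      by (intro nn_integral_cong) (auto simp: indicator_def)
    also have "\<dots> = ennreal (\<integral>\<omega>\<in>A. ?f \<omega> \<partial>M)"
      unfolding set_lebesgue_integral_def real_scaleR_def
      by (intro nn_integral_eq_integral integrable_mult_indicator[OF AM fi, unfolded real_scaleR_def]) auto
    also have "(\<integral>\<omega>\<in>A. ?f \<omega> \<partial>M) = (\<integral>\<omega>\<in>A. real_cond_exp M (F t) ?f \<omega> \<partial>M)"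
      by (rule sub.real_cond_exp_intA[OF fi A])
    also have "\<dots> = (\<integral>\<omega>\<in>A. ?g \<omega> \<partial>M)"
      unfolding set_lebesgue_integral_def
      using S_Markov[of t s] AM by (intro integral_cong_AE) (auto simp: indicator_def)
    also have "ennreal \<dots> = (\<integral>\<^sup>+\<omega>. ennreal (indicator A \<omega> * ?g \<omega>) \<partial>M)"
      unfolding set_lebesgue_integral_def real_scaleR_def
      by (intro nn_integral_eq_integral[symmetric] integrable_mult_indicator[OF AM gi, unfolded real_scaleR_def]) auto
    also have "\<dots> = (\<integral>\<^sup>+\<omega>. ennreal (?g \<omega>) * indicator A \<omega> \<partial>M)"
      by (intro nn_integral_cong) (auto simp: indicator_def)
    finally show "(\<integral>\<^sup>+\<omega>. ennreal (?f \<omega>) * indicator A \<omega> \<partial>M) = (\<integral>\<^sup>+\<omega>. ennreal (?g \<omega>) * indicator A \<omega> \<partial>M)" .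
  qed auto
  then have "(\<integral>\<^sup>+\<omega>. u \<omega> * ennreal (?g \<omega>) \<partial>M)
      = (\<integral>\<^sup>+\<omega>. u \<omega> * nn_cond_exp M (F t) (\<lambda>\<omega>. ennreal (?f \<omega>)) \<omega> \<partial>M)"
    by (intro nn_integral_cong_AE) auto
  also have "\<dots> = (\<integral>\<^sup>+\<omega>. u \<omega> * ennreal (?f \<omega>) \<partial>M)"
    using u by (intro sub.nn_cond_exp_intg) auto
  also have "\<dots> = (\<integral>\<^sup>+\<omega>. u \<omega> * indicator {s} (S (Suc t) \<omega>) \<partial>M)"
    by (intro nn_integral_cong) (auto simp: indicator_def)
  finally show ?thesis by simp
qed

locale countable_policy = feasible_policy N s0 M F S x
  for N :: "('s::countable, 'a) network" and s0 and M :: "'w measure" and F S x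
begin

text \<open>The integrand may depend on the past through \<omega>, provided it is known at time t;
  this allows the backlog to be frozen while the state moves. Countability reduces it by Tonelli to
  single target states.\<close>

lemma nn_integral_next_state:
  fixes u :: "'s \<Rightarrow> 'w \<Rightarrow> ennreal"
  assumes u: "\<And>s. u s \<in> borel_measurable (F t)"
  shows "(\<integral>\<^sup>+\<omega>. u (S (Suc t) \<omega>) \<omega> \<partial>M) = (\<integral>\<^sup>+\<omega>. \<integral>\<^sup>+s. u s \<omega> \<partial>kernel N (S t \<omega>) \<partial>M)"
proof -
  interpret c: sigma_finite_measure "count_space (UNIV :: 's set)"
    by (rule sigma_finite_measure_count_space)
  interpret pair_sigma_finite "count_space (UNIV :: 's set)" M
    by unfold_locales
  have uM [measurable]: "u s \<in> borel_measurable M" for s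
    by (rule measurable_from_subalg[OF sub_algebra u])
  have "(\<integral>\<^sup>+\<omega>. u (S (Suc t) \<omega>) \<omega> \<partial>M)
      = (\<integral>\<^sup>+\<omega>. \<integral>\<^sup>+s. u s \<omega> * indicator {s} (S (Suc t) \<omega>) \<partial>count_space UNIV \<partial>M)"
  proof (rule nn_integral_cong)
    fix \<omega>
    have "(\<integral>\<^sup>+s. u s \<omega> * indicator {s} (S (Suc t) \<omega>) \<partial>count_space UNIV)
        = (\<integral>\<^sup>+s. u (S (Suc t) \<omega>) \<omega> * indicator {S (Suc t) \<omega>} s \<partial>count_space UNIV)"
      by (intro nn_integral_cong) (auto simp: indicator_def)
    then show "u (S (Suc t) \<omega>) \<omega> = (\<integral>\<^sup>+s. u s \<omega> * indicator {s} (S (Suc t) \<omega>) \<partial>count_space UNIV)"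
      by (simp add: nn_integral_cmult_indicator)
  qed
  also have "\<dots> = (\<integral>\<^sup>+s. \<integral>\<^sup>+\<omega>. u s \<omega> * indicator {s} (S (Suc t) \<omega>) \<partial>M \<partial>count_space UNIV)"
    by (rule Fubini', rule measurable_pair_measure_countable1) auto
  also have "\<dots> = (\<integral>\<^sup>+s. \<integral>\<^sup>+\<omega>. u s \<omega> * ennreal (pmf (kernel N (S t \<omega>)) s) \<partial>M \<partial>count_space UNIV)"
    by (intro nn_integral_cong nn_integral_next_state_single u)
  also have "\<dots> = (\<integral>\<^sup>+\<omega>. \<integral>\<^sup>+s. u s \<omega> * ennreal (pmf (kernel N (S t \<omega>)) s) \<partial>count_space UNIV \<partial>M)"
    by (rule Fubini'[symmetric], rule measurable_pair_measure_countable1) auto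
  also have "\<dots> = (\<integral>\<^sup>+\<omega>. \<integral>\<^sup>+s. u s \<omega> \<partial>kernel N (S t \<omega>) \<partial>M)"
    by (simp add: nn_integral_measure_pmf mult.commute)
  finally show ?thesis .
qed

lemma integral_next_state_nonneg:
  fixes u :: "'s \<Rightarrow> 'w \<Rightarrow> real"
  assumes u: "\<And>s. u s \<in> borel_measurable (F t)" "\<And>s \<omega>. 0 \<le> u s \<omega>"
    and int: "\<And>s \<omega>. integrable (kernel N s) (\<lambda>s'. u s' \<omega>)"
    and int': "integrable M (\<lambda>\<omega>. measure_pmf.expectation (kernel N (S t \<omega>)) (\<lambda>s. u s \<omega>))"
  shows "integrable M (\<lambda>\<omega>. u (S (Suc t) \<omega>) \<omega>)"
    and "(\<integral>\<omega>. u (S (Suc t) \<omega>) \<omega> \<partial>M)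
      = (\<integral>\<omega>. measure_pmf.expectation (kernel N (S t \<omega>)) (\<lambda>s. u s \<omega>) \<partial>M)"
proof -
  let ?v = "\<lambda>\<omega>. measure_pmf.expectation (kernel N (S t \<omega>)) (\<lambda>s. u s \<omega>)"
  have uM [measurable]: "u s \<in> borel_measurable M" for s
    by (rule measurable_from_subalg[OF sub_algebra u(1)])
  have [measurable]: "(\<lambda>\<omega>. u (S (Suc t) \<omega>) \<omega>) \<in> borel_measurable M"
    by (rule measurable_compose_countable[OF uM S_measurable])
  have "(\<integral>\<^sup>+\<omega>. ennreal (u (S (Suc t) \<omega>) \<omega>) \<partial>M) = (\<integral>\<^sup>+\<omega>. \<integral>\<^sup>+s. ennreal (u s \<omega>) \<partial>kernel N (S t \<omega>) \<partial>M)"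
    using u(1) by (intro nn_integral_next_state[of "\<lambda>s \<omega>. ennreal (u s \<omega>)"]) auto
  also have "\<dots> = (\<integral>\<^sup>+\<omega>. ennreal (?v \<omega>) \<partial>M)"
    using int u(2) by (intro nn_integral_cong nn_integral_eq_integral) auto
  also have "\<dots> = ennreal (\<integral>\<omega>. ?v \<omega> \<partial>M)"
    using int' u(2) by (intro nn_integral_eq_integral) (auto intro!: Bochner_Integration.integral_nonneg)
  finally have *: "(\<integral>\<^sup>+\<omega>. ennreal (u (S (Suc t) \<omega>) \<omega>) \<partial>M) = ennreal (\<integral>\<omega>. ?v \<omega> \<partial>M)" .
  then show i: "integrable M (\<lambda>\<omega>. u (S (Suc t) \<omega>) \<omega>)"
    using u(2) by (intro integrableI_nonneg) auto
  show "(\<integral>\<omega>. u (S (Suc t) \<omega>) \<omega> \<partial>M) = (\<integral>\<omega>. ?v \<omega> \<partial>M)"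
    using * u(2) by (intro integral_eq_nn_integral[THEN trans]) (auto intro!: Bochner_Integration.integral_nonneg)
qed

text \<open>For signed u, apply the nonnegative version to u + w and to w, then subtract. The
  dominating w need not be bounded, which suits correctors dominated by hitting times.\<close>

lemma integral_next_state:
  fixes u w :: "'s \<Rightarrow> 'w \<Rightarrow> real"
  assumes u: "\<And>s. u s \<in> borel_measurable (F t)" and w: "\<And>s. w s \<in> borel_measurable (F t)"
    and le: "\<And>s \<omega>. \<bar>u s \<omega>\<bar> \<le> w s \<omega>"
    and int: "\<And>s \<omega>. integrable (kernel N s) (\<lambda>s'. w s' \<omega>)"
    and int': "integrable M (\<lambda>\<omega>. measure_pmf.expectation (kernel N (S t \<omega>)) (\<lambda>s. w s \<omega>))"
    and meas: "(\<lambda>\<omega>. measure_pmf.expectation (kernel N (S t \<omega>)) (\<lambda>s. u s \<omega>)) \<in> borel_measurable M"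
  shows "integrable M (\<lambda>\<omega>. u (S (Suc t) \<omega>) \<omega>)"
    and "integrable M (\<lambda>\<omega>. measure_pmf.expectation (kernel N (S t \<omega>)) (\<lambda>s. u s \<omega>))"
    and "(\<integral>\<omega>. u (S (Suc t) \<omega>) \<omega> \<partial>M)
      = (\<integral>\<omega>. measure_pmf.expectation (kernel N (S t \<omega>)) (\<lambda>s. u s \<omega>) \<partial>M)"
proof -
  let ?v = "\<lambda>\<omega>. measure_pmf.expectation (kernel N (S t \<omega>)) (\<lambda>s. u s \<omega>)"
  let ?z = "\<lambda>\<omega>. measure_pmf.expectation (kernel N (S t \<omega>)) (\<lambda>s. w s \<omega>)"
  have w0: "0 \<le> w s \<omega>" for s \<omega> using le[of s \<omega>] by linarith
  have iu: "integrable (kernel N s) (\<lambda>s'. u s' \<omega>)" for s \<omega>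
    by (rule Bochner_Integration.integrable_bound[OF int]) (use le in \<open>auto intro: order_trans[OF _ abs_ge_self]\<close>)
  show iv: "integrable M ?v"
    by (rule Bochner_Integration.integrable_bound[OF int' meas])
      (use abs_expectation_le[OF le int] in \<open>auto intro: order_trans[OF _ abs_ge_self]\<close>)
  have vz: "measure_pmf.expectation (kernel N (S t \<omega>)) (\<lambda>s. u s \<omega> + w s \<omega>) = ?v \<omega> + ?z \<omega>" for \<omega>
    using iu int by (rule Bochner_Integration.integral_add)
  have nn: "0 \<le> u s \<omega> + w s \<omega>" for s \<omega> using le[of s \<omega>] by linarith
  have i1: "integrable M (\<lambda>\<omega>. u (S (Suc t) \<omega>) \<omega> + w (S (Suc t) \<omega>) \<omega>)"
    and e1: "(\<integral>\<omega>. u (S (Suc t) \<omega>) \<omega> + w (S (Suc t) \<omega>) \<omega> \<partial>M) = (\<integral>\<omega>. ?v \<omega> + ?z \<omega> \<partial>M)"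
    using integral_next_state_nonneg[of "\<lambda>s \<omega>. u s \<omega> + w s \<omega>" t] u w nn iu int iv int' vz by auto
  have i2: "integrable M (\<lambda>\<omega>. w (S (Suc t) \<omega>) \<omega>)"
    and e2: "(\<integral>\<omega>. w (S (Suc t) \<omega>) \<omega> \<partial>M) = (\<integral>\<omega>. ?z \<omega> \<partial>M)"
    using integral_next_state_nonneg[of w t] w w0 int int' by auto
  show iS: "integrable M (\<lambda>\<omega>. u (S (Suc t) \<omega>) \<omega>)"
    using Bochner_Integration.integrable_diff[OF i1 i2] by simp
  show "(\<integral>\<omega>. u (S (Suc t) \<omega>) \<omega> \<partial>M) = (\<integral>\<omega>. ?v \<omega> \<partial>M)"
    using e1 e2 iS i2 iv int' by simp
qed

end

section \<open>The Poisson equation of the network\<close>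

context square_integrable_hitting
begin

abbreviation mean_return :: real where
  "mean_return \<equiv> potential K a (\<lambda>_. 1) a"

text \<open>For the return time T of \<open>a\<close> this is E[T(T+1)]/2 - E T = E[T(T-1)]/2, half
  of the constant D.\<close>

definition half_D :: real where
  "half_D = (\<Sum>m. real (Suc m) * surv K a m a) - mean_return"

text \<open>The mean remaining time falls by one per slot and is recharged by a full mean cycle
  whenever the chain is at \<open>a\<close>.\<close>

lemma expectation_hit1_eq:
  "measure_pmf.expectation (K s) hit1 = hit1 s - 1 + mean_return * indicator {a} s"
  by (auto simp: expectation_hit1 hit1_def)

lemma expectation_hit2_eq:
  "measure_pmf.expectation (K s) hit2 = hit2 s - hit1 s + half_D * indicator {a} s"
  by (auto simp: expectation_hit2 hit1_def hit2_def half_D_def)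

end

text \<open>Nonempty action sets keep the infimum in \<open>min_penalty\<close> meaningful; the
  final proof obtains them from the slackness witnesses.\<close>

locale network_potential =
  stochastic_network N \<pi> \<delta> + square_integrable_hitting "kernel N" a
  for N :: "('s::countable, 'b::topological_space) network" and \<pi> \<delta> a +
  assumes actions_nonempty: "actions N s \<noteq> {}"
begin

abbreviation J :: "nat set" where "J \<equiv> {1..num_queues N}"

definition penalty :: "real \<Rightarrow> (nat \<Rightarrow> real) \<Rightarrow> 's \<Rightarrow> 'b \<Rightarrow> real" where
  "penalty V q s y = V * cost N s y + (\<Sum>j\<in>J. q j * (arrival N j s y - service N j s y))"

text \<open>The function g of the overview. An infimum is used because for arbitrary multipliers q a
  minimizing action need not exist.\<close>

definition min_penalty :: "real \<Rightarrow> (nat \<Rightarrow> real) \<Rightarrow> 's \<Rightarrow> real" where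
  "min_penalty V q s = (INF y\<in>actions N s. penalty V q s y)"

text \<open>The function G of the overview: the Lagrange dual function, at multipliers q, of
  minimizing V times the stationary mean cost subject to nonpositive mean net arrivals.\<close>

definition dual :: "real \<Rightarrow> (nat \<Rightarrow> real) \<Rightarrow> real" where
  "dual V q = measure_pmf.expectation \<pi> (min_penalty V q)"

definition bound :: "real \<Rightarrow> (nat \<Rightarrow> real) \<Rightarrow> real" where
  "bound V q = V * \<delta> + \<delta> * (\<Sum>j\<in>J. \<bar>q j\<bar>)"

text \<open>\<open>corrector V q\<close> solves the Poisson equation with right-hand side
  \<open>min_penalty V q - dual V q\<close> (see \<open>expectation_corrector\<close>).\<close>

definition corrector :: "real \<Rightarrow> (nat \<Rightarrow> real) \<Rightarrow> 's \<Rightarrow> real" where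
  "corrector V q s = (if s = a then 0
     else potential (kernel N) a (\<lambda>s'. min_penalty V q s' - dual V q) s)"

lemma net_arrival_bounded:
  assumes "j \<in> J" "y \<in> actions N s"
  shows "\<bar>arrival N j s y - service N j s y\<bar> \<le> \<delta>"
  using arrival_nonneg[OF assms] arrival_bounded[OF assms] service_nonneg[OF assms] service_bounded[OF assms]
  by linarith

lemma bound_nonneg: "0 \<le> V \<Longrightarrow> 0 \<le> bound V q"
  unfolding bound_def using \<delta>_pos by (intro add_nonneg_nonneg mult_nonneg_nonneg sum_nonneg) auto

lemma penalty_bounded:
  assumes "0 \<le> V" "y \<in> actions N s"
  shows "\<bar>penalty V q s y\<bar> \<le> bound V q"
proof -
  have "\<bar>V * cost N s y\<bar> \<le> V * \<delta>"
    using cost_bounded[OF assms(2)] assms(1) by (simp add: abs_mult mult_left_mono)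
  moreover have "\<bar>\<Sum>j\<in>J. q j * (arrival N j s y - service N j s y)\<bar> \<le> (\<Sum>j\<in>J. \<delta> * \<bar>q j\<bar>)"
    by (rule order_trans[OF sum_abs])
      (auto intro!: sum_mono mult_right_mono net_arrival_bounded assms simp: abs_mult mult.commute[of "\<bar>q _\<bar>"])
  ultimately show ?thesis
    unfolding penalty_def bound_def sum_distrib_left by linarith
qed

text \<open>The cost term cancels, so the constant depends neither on V nor on the state. It is
  \<delta> and not 2\<delta> since arrival and service both lie between 0 and \<delta>.\<close>

lemma penalty_Lipschitz:
  assumes "y \<in> actions N s"
  shows "\<bar>penalty V q s y - penalty V q' s y\<bar> \<le> \<delta> * (\<Sum>j\<in>J. \<bar>q j - q' j\<bar>)"
proof -
  have "penalty V q s y - penalty V q' s y = (\<Sum>j\<in>J. (q j - q' j) * (arrival N j s y - service N j s y))"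
    unfolding penalty_def by (simp add: sum_subtractf[symmetric] algebra_simps)
  also have "\<bar>\<dots>\<bar> \<le> (\<Sum>j\<in>J. \<delta> * \<bar>q j - q' j\<bar>)"
    by (rule order_trans[OF sum_abs])
      (auto intro!: sum_mono mult_right_mono net_arrival_bounded assms simp: abs_mult mult.commute[of "\<bar>q _ - q' _\<bar>"])
  finally show ?thesis by (simp add: sum_distrib_left)
qed

lemma penalty_bdd_below:
  assumes "0 \<le> V"
  shows "bdd_below (penalty V q s ` actions N s)"
proof (rule bdd_belowI2[where m="- bound V q"])
  show "- bound V q \<le> penalty V q s y" if "y \<in> actions N s" for y
    using penalty_bounded[OF assms that, of q] by linarith
qed

lemma min_penalty_le:
  assumes "0 \<le> V" "y \<in> actions N s"
  shows "min_penalty V q s \<le> penalty V q s y"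
  unfolding min_penalty_def using assms by (intro cINF_lower penalty_bdd_below)

lemma min_penalty_bounded:
  assumes "0 \<le> V"
  shows "\<bar>min_penalty V q s\<bar> \<le> bound V q"
proof -
  obtain y where y: "y \<in> actions N s" using actions_nonempty by blast
  have "- bound V q \<le> min_penalty V q s"
    unfolding min_penalty_def using penalty_bounded[OF assms, of _ s q] actions_nonempty
    by (intro cINF_greatest) (auto simp: abs_le_iff minus_le_iff)
  moreover have "min_penalty V q s \<le> bound V q"
    using min_penalty_le[OF assms y, of q] penalty_bounded[OF assms y, of q] by linarith
  ultimately show ?thesis by linarith
qed

lemma min_penalty_Lipschitz:
  assumes "0 \<le> V"
  shows "\<bar>min_penalty V q s - min_penalty V q' s\<bar> \<le> \<delta> * (\<Sum>j\<in>J. \<bar>q j - q' j\<bar>)"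
proof -
  have *: "min_penalty V q s - \<delta> * (\<Sum>j\<in>J. \<bar>q j - q' j\<bar>) \<le> min_penalty V q' s" for q q'
    unfolding min_penalty_def[of V q']
  proof (rule cINF_greatest[OF actions_nonempty])
    fix y assume y: "y \<in> actions N s"
    show "min_penalty V q s - \<delta> * (\<Sum>j\<in>J. \<bar>q j - q' j\<bar>) \<le> penalty V q' s y"
      using min_penalty_le[OF assms y, of q] penalty_Lipschitz[OF y, of V q q'] by linarith
  qed
  show ?thesis
    using *[of q q'] *[of q' q] by (simp add: abs_minus_commute abs_le_iff algebra_simps)
qed

lemma integrable_min_penalty: "0 \<le> V \<Longrightarrow> integrable (measure_pmf p) (min_penalty V q)"
  by (rule integrable_measure_pmf_bounded[OF min_penalty_bounded])

lemma dual_bounded: "0 \<le> V \<Longrightarrow> \<bar>dual V q\<bar> \<le> bound V q"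
  unfolding dual_def by (intro abs_expectation_le_const min_penalty_bounded)

lemma dual_Lipschitz:
  assumes "0 \<le> V"
  shows "\<bar>dual V q - dual V q'\<bar> \<le> \<delta> * (\<Sum>j\<in>J. \<bar>q j - q' j\<bar>)"
proof -
  have "dual V q - dual V q' = measure_pmf.expectation \<pi> (\<lambda>s. min_penalty V q s - min_penalty V q' s)"
    unfolding dual_def using assms by (intro Bochner_Integration.integral_diff[symmetric] integrable_min_penalty)
  then show ?thesis
    using abs_expectation_le_const[OF min_penalty_Lipschitz[OF assms, of q _ q'], of \<pi>] by simp
qed

lemma centred_bounded: "0 \<le> V \<Longrightarrow> \<bar>min_penalty V q s - dual V q\<bar> \<le> 2 * bound V q"
  using min_penalty_bounded[of V q s] dual_bounded[of V q] by linarith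

lemma corrector_bounded:
  assumes "0 \<le> V"
  shows "\<bar>corrector V q s\<bar> \<le> 2 * bound V q * hit1 s"
  using potential_le[of "\<lambda>s'. min_penalty V q s' - dual V q" "2 * bound V q" s] centred_bounded[OF assms]
  by (simp add: corrector_def hit1_def)

text \<open>The potential is linear in its argument, so the difference is the potential of a
  function bounded by twice the Lipschitz bound, accumulated over the time to reach
  \<open>a\<close>.\<close>

lemma corrector_Lipschitz:
  assumes "0 \<le> V"
  shows "\<bar>corrector V q s - corrector V q' s\<bar> \<le> 2 * \<delta> * hit1 s * (\<Sum>j\<in>J. \<bar>q j - q' j\<bar>)"
proof (cases "s = a")
  case False
  let ?\<phi> = "\<lambda>q s'. min_penalty V q s' - dual V q"
  have "\<bar>?\<phi> q s' - ?\<phi> q' s'\<bar> \<le> 2 * (\<delta> * (\<Sum>j\<in>J. \<bar>q j - q' j\<bar>))" for s'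
    using min_penalty_Lipschitz[OF assms, of q s' q'] dual_Lipschitz[OF assms, of q q'] by linarith
  then have "\<bar>potential (kernel N) a (\<lambda>s'. ?\<phi> q s' - ?\<phi> q' s') s\<bar> \<le> 2 * (\<delta> * (\<Sum>j\<in>J. \<bar>q j - q' j\<bar>)) * hit1 s"
    using potential_le[of "\<lambda>s'. ?\<phi> q s' - ?\<phi> q' s'" "2 * (\<delta> * (\<Sum>j\<in>J. \<bar>q j - q' j\<bar>))" s] False
    by (simp add: hit1_def)
  moreover have "potential (kernel N) a (\<lambda>s'. ?\<phi> q s' - ?\<phi> q' s') s = corrector V q s - corrector V q' s"
    unfolding corrector_def
    using False potential_diff[of "?\<phi> q" _ "?\<phi> q'", OF centred_bounded[OF assms] centred_bounded[OF assms]] by simp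
  ultimately show ?thesis by (simp add: mult_ac)
qed (simp add: corrector_def hit1_def)

text \<open>The centred function has stationary mean zero, so by the cycle formula its potential
  over a full cycle vanishes. Hence the value 0 assigned at \<open>a\<close> is the right one and no
  source term appears there.\<close>

lemma expectation_corrector:
  assumes "0 \<le> V"
  shows "measure_pmf.expectation (kernel N s) (corrector V q) = corrector V q s - min_penalty V q s + dual V q"
proof -
  let ?\<phi> = "\<lambda>s'. min_penalty V q s' - dual V q"
  have "measure_pmf.expectation \<pi> ?\<phi> = 0"
    using integrable_min_penalty[OF assms, of \<pi> q] by (simp add: dual_def)
  then have "potential (kernel N) a ?\<phi> a = 0"
    using cycle_formula[of \<pi> ?\<phi>, OF _ centred_bounded[OF assms]] stationary
    by (simp add: stationary_distribution_def)
  moreover have "measure_pmf.expectation (kernel N s) (corrector V q) = potential (kernel N) a ?\<phi> s - ?\<phi> s"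
    using potential_step[of ?\<phi>, OF centred_bounded[OF assms]] by (simp add: corrector_def[abs_def])
  ultimately show ?thesis by (auto simp: corrector_def)
qed

lemma measurable_min_penalty [measurable]:
  assumes "0 \<le> V"
  shows "(\<lambda>q. min_penalty V q s) \<in> borel_measurable borel"
  by (rule borel_measurable_coordinate_Lipschitz[where c=\<delta> and J=J]) (rule min_penalty_Lipschitz[OF assms])

lemma measurable_dual [measurable]:
  assumes "0 \<le> V"
  shows "dual V \<in> borel_measurable borel"
  by (rule borel_measurable_coordinate_Lipschitz[where c=\<delta> and J=J]) (rule dual_Lipschitz[OF assms])

lemma measurable_corrector [measurable]:
  assumes "0 \<le> V"
  shows "(\<lambda>q. corrector V q s) \<in> borel_measurable borel"
  by (rule borel_measurable_coordinate_Lipschitz[where c="2 * \<delta> * hit1 s" and J=J]) (rule corrector_Lipschitz[OF assms])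

text \<open>An infimum is below every convex combination of values, here the mixture of actions
  supplied by slackness; averaging over \<pi> turns its drift into -\<eta> for each queue.\<close>

lemma dual_slackness:
  assumes slack: "slackness N \<pi> \<eta>" and V: "0 \<le> V" and q: "\<And>j. j \<in> J \<Longrightarrow> 0 \<le> q j"
    and c: "\<And>s y. y \<in> actions N s \<Longrightarrow> cost N s y \<le> c"
  shows "dual V q \<le> V * c - \<eta> * (\<Sum>j\<in>J. q j)"
proof -
  define I :: "nat set" where "I = {1..num_queues N + 2}"
  obtain x \<theta> where x: "\<And>s k. k \<in> I \<Longrightarrow> x s k \<in> actions N s"
    and \<theta>: "\<And>s k. k \<in> I \<Longrightarrow> 0 \<le> \<theta> s k" "\<And>s. (\<Sum>k\<in>I. \<theta> s k) = 1"
    and \<eta>: "\<And>j. j \<in> J \<Longrightarrow> (\<Sum>\<^sub>\<infinity>s. pmf \<pi> s *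
              (\<Sum>k\<in>I. \<theta> s k * (arrival N j s (x s k) - service N j s (x s k)))) \<le> - \<eta>"
    using slack unfolding slackness_def I_def by blast
  define d where "d j s = (\<Sum>k\<in>I. \<theta> s k * (arrival N j s (x s k) - service N j s (x s k)))" for j s
  have d: "\<bar>d j s\<bar> \<le> \<delta>" if "j \<in> J" for j s
  proof -
    have "\<bar>d j s\<bar> \<le> (\<Sum>k\<in>I. \<theta> s k * \<delta>)"
      unfolding d_def by (rule order_trans[OF sum_abs])
        (auto intro!: sum_mono mult_left_mono net_arrival_bounded that x \<theta>(1) simp: abs_mult abs_of_nonneg[OF \<theta>(1)])
    then show ?thesis using \<theta>(2) by (simp add: sum_distrib_right[symmetric])
  qed
  have di: "integrable (measure_pmf \<pi>) (d j)" if "j \<in> J" for j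
    by (rule integrable_measure_pmf_bounded[OF d[OF that]])
  have dm: "measure_pmf.expectation \<pi> (d j) \<le> - \<eta>" if "j \<in> J" for j
  proof -
    \<comment> \<open>Slackness is stated with an unordered infinite sum; boundedness of the drift
      makes it absolutely convergent and equal to the expectation under \<pi>.\<close>
    have "integrable (count_space UNIV) (\<lambda>s. pmf \<pi> s * d j s)"
      using di[OF that] unfolding measure_pmf_eq_density by (subst (asm) integrable_density) auto
    then have "Infinite_Set_Sum.abs_summable_on (\<lambda>s. pmf \<pi> s * d j s) UNIV"
      by (simp add: Infinite_Set_Sum.abs_summable_on_def)
    from infsetsum_infsum[OF this] show ?thesis
      using \<eta>[OF that, folded d_def] by (simp add: pmf_expectation_eq_infsetsum)
  qed
  have "min_penalty V q s \<le> V * c + (\<Sum>j\<in>J. q j * d j s)" for s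
  proof -
    have "min_penalty V q s = (\<Sum>k\<in>I. \<theta> s k * min_penalty V q s)"
      using \<theta>(2) by (simp add: sum_distrib_right[symmetric])
    also have "\<dots> \<le> (\<Sum>k\<in>I. \<theta> s k * (V * c + (\<Sum>j\<in>J. q j * (arrival N j s (x s k) - service N j s (x s k)))))"
    proof (intro sum_mono mult_left_mono \<theta>(1))
      fix k assume k: "k \<in> I"
      have "V * cost N s (x s k) \<le> V * c" using c[OF x[OF k]] V by (rule mult_left_mono)
      then show "min_penalty V q s \<le> V * c + (\<Sum>j\<in>J. q j * (arrival N j s (x s k) - service N j s (x s k)))"
        using min_penalty_le[OF V x[OF k, of s], of q] unfolding penalty_def by linarith
    qed
    also have "\<dots> = (\<Sum>k\<in>I. \<theta> s k * (V * c))
        + (\<Sum>k\<in>I. \<Sum>j\<in>J. \<theta> s k * (q j * (arrival N j s (x s k) - service N j s (x s k))))"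
      by (simp only: distrib_left sum.distrib sum_distrib_left)
    also have "(\<Sum>k\<in>I. \<theta> s k * (V * c)) = V * c"
      using \<theta>(2) by (simp add: sum_distrib_right[symmetric])
    also have "(\<Sum>k\<in>I. \<Sum>j\<in>J. \<theta> s k * (q j * (arrival N j s (x s k) - service N j s (x s k))))
        = (\<Sum>j\<in>J. q j * d j s)"
      unfolding d_def sum_distrib_left by (subst sum.swap) (simp only: mult.left_commute)
    finally show ?thesis .
  qed
  moreover have int: "integrable (measure_pmf \<pi>) (\<lambda>s. \<Sum>j\<in>J. q j * d j s)"
    by (intro Bochner_Integration.integrable_sum integrable_mult_right di)
  ultimately have "dual V q \<le> measure_pmf.expectation \<pi> (\<lambda>s. V * c + (\<Sum>j\<in>J. q j * d j s))"
    unfolding dual_def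
    by (intro integral_mono integrable_min_penalty V Bochner_Integration.integrable_add) (auto simp only: measure_pmf.integrable_const)
  also have "\<dots> = V * c + measure_pmf.expectation \<pi> (\<lambda>s. \<Sum>j\<in>J. q j * d j s)"
    using int by (subst Bochner_Integration.integral_add) auto
  also have "measure_pmf.expectation \<pi> (\<lambda>s. \<Sum>j\<in>J. q j * d j s) = (\<Sum>j\<in>J. q j * measure_pmf.expectation \<pi> (d j))"
    by (subst Bochner_Integration.integral_sum) (auto intro: di simp del: atLeastAtMost_iff)
  also have "(\<Sum>j\<in>J. q j * measure_pmf.expectation \<pi> (d j)) \<le> (\<Sum>j\<in>J. q j * (- \<eta>))"
    by (intro sum_mono mult_left_mono dm q)
  also have "\<dots> = - (\<eta> * (\<Sum>j\<in>J. q j))"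
    by (simp only: sum_distrib_right[symmetric]) simp
  finally show ?thesis by simp
qed

end

section \<open>State process and backlogs under a policy\<close>

context network_potential
begin

lemma queue_bounds:
  assumes \<alpha>: "\<And>\<tau>. \<alpha> \<tau> \<in> actions N (\<sigma> \<tau>)" and j: "j \<in> J"
  shows "0 \<le> queue N j \<sigma> \<alpha> t" "queue N j \<sigma> \<alpha> t \<le> real t * \<delta>"
proof -
  have "0 \<le> queue N j \<sigma> \<alpha> t \<and> queue N j \<sigma> \<alpha> t \<le> real t * \<delta>"
  proof (induction t)
    case (Suc t)
    then show ?case
      using arrival_nonneg[OF j \<alpha>[of t]] arrival_bounded[OF j \<alpha>[of t]] service_nonneg[OF j \<alpha>[of t]]
      by (auto simp: max_def algebra_simps)
  qed simp
  then show "0 \<le> queue N j \<sigma> \<alpha> t" "queue N j \<sigma> \<alpha> t \<le> real t * \<delta>" by auto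
qed

text \<open>In the quadratic bound, truncation at 0 only lowers the square, and the cross term uses
  that the backlog after service is at most the old one; \<mu>^2 and A^2 contribute one \<delta>^2
  each.\<close>

lemma queue_step:
  assumes \<alpha>: "\<And>\<tau>. \<alpha> \<tau> \<in> actions N (\<sigma> \<tau>)" and j: "j \<in> J"
  defines "A \<equiv> \<lambda>t. arrival N j (\<sigma> t) (\<alpha> t)" and "\<mu> \<equiv> \<lambda>t. service N j (\<sigma> t) (\<alpha> t)"
  shows "\<bar>queue N j \<sigma> \<alpha> (Suc t) - queue N j \<sigma> \<alpha> t\<bar> \<le> \<delta>"
    and "queue N j \<sigma> \<alpha> t + (A t - \<mu> t) \<le> queue N j \<sigma> \<alpha> (Suc t)"
    and "(queue N j \<sigma> \<alpha> (Suc t))\<^sup>2 \<le> (queue N j \<sigma> \<alpha> t)\<^sup>2 + 2 * \<delta>\<^sup>2 + 2 * (queue N j \<sigma> \<alpha> t * (A t - \<mu> t))"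
proof -
  let ?q = "queue N j \<sigma> \<alpha> t"
  have A: "0 \<le> A t" "A t \<le> \<delta>" and \<mu>: "0 \<le> \<mu> t" "\<mu> t \<le> \<delta>"
    unfolding A_def \<mu>_def
    using arrival_nonneg[OF j \<alpha>[of t]] arrival_bounded[OF j \<alpha>[of t]]
      service_nonneg[OF j \<alpha>[of t]] service_bounded[OF j \<alpha>[of t]] by auto
  have q: "0 \<le> ?q" by (rule queue_bounds(1)[OF \<alpha> j])
  have Suc: "queue N j \<sigma> \<alpha> (Suc t) = max (?q - \<mu> t) 0 + A t"
    by (simp add: A_def \<mu>_def)
  show "\<bar>queue N j \<sigma> \<alpha> (Suc t) - ?q\<bar> \<le> \<delta>" "?q + (A t - \<mu> t) \<le> queue N j \<sigma> \<alpha> (Suc t)"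
    unfolding Suc using A \<mu> q by (auto simp: max_def)
  have m: "(max (?q - \<mu> t) 0)\<^sup>2 \<le> (?q - \<mu> t)\<^sup>2" "max (?q - \<mu> t) 0 \<le> ?q"
    using q \<mu> by (auto simp: max_def)
  have "(max (?q - \<mu> t) 0 + A t)\<^sup>2 = (max (?q - \<mu> t) 0)\<^sup>2 + (A t)\<^sup>2 + 2 * (max (?q - \<mu> t) 0 * A t)"
    by (simp add: power2_sum)
  also have "\<dots> \<le> (?q - \<mu> t)\<^sup>2 + (A t)\<^sup>2 + 2 * (?q * A t)"
    using m A by (intro add_mono mult_left_mono mult_right_mono) auto
  also have "\<dots> = ?q\<^sup>2 + (\<mu> t)\<^sup>2 + (A t)\<^sup>2 + 2 * (?q * (A t - \<mu> t))"
    by (simp add: power2_eq_square algebra_simps)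
  also have "\<dots> \<le> ?q\<^sup>2 + 2 * \<delta>\<^sup>2 + 2 * (?q * (A t - \<mu> t))"
    using power_mono[OF A(2) A(1), of 2] power_mono[OF \<mu>(2) \<mu>(1), of 2] by simp
  finally show "(queue N j \<sigma> \<alpha> (Suc t))\<^sup>2 \<le> ?q\<^sup>2 + 2 * \<delta>\<^sup>2 + 2 * (?q * (A t - \<mu> t))"
    unfolding Suc .
qed

lemma bound_mono:
  assumes "0 \<le> V" "\<And>j. j \<in> J \<Longrightarrow> \<bar>q j\<bar> \<le> c"
  shows "bound V q \<le> V * \<delta> + \<delta> * (real (num_queues N) * c)"
  using sum_mono[of J "\<lambda>j. \<bar>q j\<bar>" "\<lambda>_. c"] assms \<delta>_pos unfolding bound_def by (simp add: mult_left_mono)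

end

text \<open>The policy is arbitrary and the potential theory fixed: both QLA and every competitor
  are instances, and all refer to the same \<open>dual\<close>.\<close>

locale controlled_network =
  network_potential N \<pi> \<delta> a + countable_policy N s0 M F S x
  for N :: "('s::countable, 'b::topological_space) network" and \<pi> \<delta> a s0
    and M :: "'w measure" and F S x
begin

lemma AE_feasible: "AE \<omega> in M. \<forall>t. x t \<omega> \<in> actions N (S t \<omega>)"
  using action_feasible by (simp add: AE_all_countable)

text \<open>Indices outside J are set to 0 because arrivals and services there are unconstrained and
  possibly not measurable.\<close>

definition backlog :: "nat \<Rightarrow> 'w \<Rightarrow> nat \<Rightarrow> real" where
  "backlog t \<omega> j = (if j \<in> J then queue N j (\<lambda>t. S t \<omega>) (\<lambda>t. x t \<omega>) t else 0)"

lemma queue_measurable_F: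
  assumes "j \<in> J"
  shows "(\<lambda>\<omega>. queue N j (\<lambda>t. S t \<omega>) (\<lambda>t. x t \<omega>) t) \<in> borel_measurable (F t)"
proof (induction t)
  case (Suc t)
  note [measurable] = measurable_F_mono[OF Suc, of "Suc t", simplified]
    measurable_F_mono[OF arrival_adapted[OF assms], of t "Suc t", simplified]
    measurable_F_mono[OF service_adapted[OF assms], of t "Suc t", simplified]
  show ?case by simp
qed simp

lemma backlog_measurable_F: "backlog t \<in> borel_measurable (F t)"
proof (rule measurable_coordinatewise_then_product)
  show "(\<lambda>\<omega>. backlog t \<omega> j) \<in> borel_measurable (F t)" for j
  proof (cases "j \<in> J")
    case True
    then show ?thesis unfolding backlog_def by (simp only: if_True queue_measurable_F)
  next
    case False
    then show ?thesis unfolding backlog_def by (simp only: if_False borel_measurable_const)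
  qed
qed

lemma queue_measurable:
  "j \<in> J \<Longrightarrow> (\<lambda>\<omega>. queue N j (\<lambda>t. S t \<omega>) (\<lambda>t. x t \<omega>) t) \<in> borel_measurable M"
  by (rule measurable_from_subalg[OF sub_algebra queue_measurable_F])

lemma backlog_measurable [measurable]: "backlog t \<in> borel_measurable M"
  by (rule measurable_from_subalg[OF sub_algebra backlog_measurable_F])

text \<open>A deterministic bound at each fixed time gives all integrability in the backlog; its
  growth with t is harmless there.\<close>

lemma AE_backlog: "AE \<omega> in M. \<forall>j. 0 \<le> backlog t \<omega> j \<and> backlog t \<omega> j \<le> real t * \<delta>"
  using AE_feasible
proof eventually_elim
  case (elim \<omega>)
  then have "\<And>\<tau>. x \<tau> \<omega> \<in> actions N (S \<tau> \<omega>)" by blast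
  from queue_bounds[of "\<lambda>t. x t \<omega>" "\<lambda>t. S t \<omega>", OF this]
  show ?case using \<delta>_pos by (auto simp: backlog_def)
qed

lemma AE_backlog_abs: "AE \<omega> in M. \<forall>j\<in>J. \<bar>backlog t \<omega> j\<bar> \<le> real t * \<delta>"
  using AE_backlog[of t] by eventually_elim auto

lemma integrable_queue:
  assumes "j \<in> J"
  shows "integrable M (\<lambda>\<omega>. queue N j (\<lambda>t. S t \<omega>) (\<lambda>t. x t \<omega>) t)"
proof (rule integrable_const_bound[where B="real t * \<delta>"])
  show "AE \<omega> in M. norm (queue N j (\<lambda>t. S t \<omega>) (\<lambda>t. x t \<omega>) t) \<le> real t * \<delta>"
    using AE_backlog[of t]
  proof eventually_elim
    case (elim \<omega>)
    then show ?case using assms by (auto simp: backlog_def dest!: spec[of _ j])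
  qed
qed (rule queue_measurable[OF assms])

lemma integrable_queue_square:
  assumes "j \<in> J"
  shows "integrable M (\<lambda>\<omega>. (queue N j (\<lambda>t. S t \<omega>) (\<lambda>t. x t \<omega>) t)\<^sup>2)"
proof (rule integrable_const_bound[where B="(real t * \<delta>)\<^sup>2"])
  show "AE \<omega> in M. norm ((queue N j (\<lambda>t. S t \<omega>) (\<lambda>t. x t \<omega>) t)\<^sup>2) \<le> (real t * \<delta>)\<^sup>2"
    using AE_backlog[of t]
  proof eventually_elim
    case (elim \<omega>)
    then show ?case using assms by (auto simp: backlog_def dest!: spec[of _ j] intro!: power_mono)
  qed
  show "(\<lambda>\<omega>. (queue N j (\<lambda>t. S t \<omega>) (\<lambda>t. x t \<omega>) t)\<^sup>2) \<in> borel_measurable M"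
    using queue_measurable[OF assms, of t] by measurable
qed

lemma integrable_cost: "integrable M (\<lambda>\<omega>. cost N (S t \<omega>) (x t \<omega>))"
proof (rule integrable_const_bound[where B=\<delta>])
  show "AE \<omega> in M. norm (cost N (S t \<omega>) (x t \<omega>)) \<le> \<delta>"
    using action_feasible[of t] by eventually_elim (auto intro: cost_bounded)
  show "(\<lambda>\<omega>. cost N (S t \<omega>) (x t \<omega>)) \<in> borel_measurable M"
    by (rule measurable_from_subalg[OF sub_algebra cost_adapted])
qed

lemma measurable_state_function: "(\<lambda>\<omega>. f (S t \<omega>)) \<in> borel_measurable M" for f :: "'s \<Rightarrow> real"
  by (rule measurable_compose[OF S_measurable]) simp

lemma hit2_nonneg: "0 \<le> hit2 s"
  using hit1_nonneg hit1_le_hit2 by (rule order_trans)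

lemma integrable_visit: "integrable M (\<lambda>\<omega>. indicator {a} (S t \<omega>) :: real)"
  by (rule integrable_const_bound[where B=1]) (auto intro: measurable_state_function simp: indicator_def)

lemma integrable_initial: "integrable M (\<lambda>\<omega>. f (S 0 \<omega>))" for f :: "'s \<Rightarrow> real"
proof -
  have "integrable M (\<lambda>\<omega>. f s0)" by simp
  moreover have "AE \<omega> in M. f s0 = f (S 0 \<omega>)" using S_initial by eventually_elim simp
  ultimately show ?thesis
    by (rule integrable_cong_AE_imp[OF _ measurable_state_function])
qed

lemma integrable_hit1I: "integrable M (\<lambda>\<omega>. hit2 (S t \<omega>)) \<Longrightarrow> integrable M (\<lambda>\<omega>. hit1 (S t \<omega>))"
  by (erule Bochner_Integration.integrable_bound[OF _ measurable_state_function])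
    (auto simp: hit1_nonneg hit2_nonneg hit1_le_hit2)

text \<open>The initial state is almost surely fixed, and each step changes the expectation only by
  finite terms according to the one-step identity.\<close>

lemma integrable_hit2_S: "integrable M (\<lambda>\<omega>. hit2 (S t \<omega>))"
proof (induction t)
  case 0
  show ?case by (rule integrable_initial)
next
  case (Suc t)
  have "integrable M (\<lambda>\<omega>. measure_pmf.expectation (kernel N (S t \<omega>)) hit2)"
    unfolding expectation_hit2_eq
    by (intro Bochner_Integration.integrable_add Bochner_Integration.integrable_diff Suc
        integrable_hit1I integrable_mult_right integrable_visit)
  then show ?case
    by (intro integral_next_state_nonneg(1)[of "\<lambda>s \<omega>. hit2 s" t] hit2_nonneg integrable_hit2) auto
qed

lemma integrable_hit1_S: "integrable M (\<lambda>\<omega>. hit1 (S t \<omega>))"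
  by (rule integrable_hit1I[OF integrable_hit2_S])

lemma integrable_hit2_tail_S: "integrable M (\<lambda>\<omega>. hit2_tail m (S t \<omega>))"
proof (rule Bochner_Integration.integrable_bound[OF integrable_hit2_S measurable_state_function])
  show "AE \<omega> in M. norm (hit2_tail m (S t \<omega>)) \<le> norm (hit2 (S t \<omega>))"
    using hit2_tail_le by (auto simp: hit2_tail_nonneg hit2_nonneg)
qed

definition mean1 :: "nat \<Rightarrow> real" where "mean1 t = (\<integral>\<omega>. hit1 (S t \<omega>) \<partial>M)"

definition mean2 :: "nat \<Rightarrow> real" where "mean2 t = (\<integral>\<omega>. hit2 (S t \<omega>) \<partial>M)"

definition visit :: "nat \<Rightarrow> real" where "visit t = (\<integral>\<omega>. indicator {a} (S t \<omega>) \<partial>M)"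

lemma mean1_Suc: "mean1 (Suc t) = mean1 t - 1 + mean_return * visit t"
proof -
  have i: "integrable M (\<lambda>\<omega>. measure_pmf.expectation (kernel N (S t \<omega>)) hit1)"
    unfolding expectation_hit1_eq using integrable_hit1_S integrable_visit by auto
  have "mean1 (Suc t) = (\<integral>\<omega>. measure_pmf.expectation (kernel N (S t \<omega>)) hit1 \<partial>M)"
    unfolding mean1_def using i
    by (intro integral_next_state_nonneg(2)[of "\<lambda>s \<omega>. hit1 s" t] hit1_nonneg integrable_hit1) auto
  also have "\<dots> = mean1 t - 1 + mean_return * visit t"
    unfolding expectation_hit1_eq mean1_def visit_def
    using integrable_hit1_S[of t] integrable_visit[of t] by (simp add: prob_space)
  finally show ?thesis .
qed

lemma mean2_Suc: "mean2 (Suc t) = mean2 t - mean1 t + half_D * visit t"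
proof -
  have i: "integrable M (\<lambda>\<omega>. measure_pmf.expectation (kernel N (S t \<omega>)) hit2)"
    unfolding expectation_hit2_eq using integrable_hit1_S integrable_hit2_S integrable_visit by auto
  have "mean2 (Suc t) = (\<integral>\<omega>. measure_pmf.expectation (kernel N (S t \<omega>)) hit2 \<partial>M)"
    unfolding mean2_def using i
    by (intro integral_next_state_nonneg(2)[of "\<lambda>s \<omega>. hit2 s" t] hit2_nonneg integrable_hit2) auto
  also have "\<dots> = mean2 t - mean1 t + half_D * visit t"
    unfolding expectation_hit2_eq mean1_def mean2_def visit_def
    using integrable_hit1_S[of t] integrable_hit2_S[of t] integrable_visit[of t] by simp
  finally show ?thesis .
qed

lemma mean1_nonneg: "0 \<le> mean1 t"
  unfolding mean1_def by (simp add: hit1_nonneg)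

lemma mean1_le_mean2: "mean1 t \<le> mean2 t"
  unfolding mean1_def mean2_def by (intro integral_mono integrable_hit1_S integrable_hit2_S hit1_le_hit2)

text \<open>Eliminating the visit probability of \<open>a\<close> between the recursions for
  \<open>mean1\<close> and \<open>mean2\<close> leaves the per-slot average
  \<open>half_D / mean_return\<close>, that is D/(2 T1), plus boundary terms.\<close>

lemma sum_mean1:
  "(\<Sum>t<n. mean1 t) = mean2 0 - mean2 n + half_D / mean_return * (real n + mean1 n - mean1 0)"
proof (induction n)
  case (Suc n)
  define c where "c = half_D / mean_return"
  have "mean_return \<noteq> 0" using return_time_ge_1[of a] by simp
  then have "half_D * visit n = c * (mean_return * visit n)" by (simp add: c_def)
  also have "\<dots> = c * (mean1 (Suc n) - mean1 n + 1)" by (simp add: mean1_Suc)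
  finally show ?case
    using Suc mean2_Suc[of n] unfolding c_def[symmetric] by (simp add: algebra_simps)
qed simp

text \<open>The truncated tail is a supermartingale off \<open>a\<close>, and a slot spent at
  \<open>a\<close> adds at most its one-step mean from there. So the linear growth rate can be made
  small by choosing m large.\<close>

lemma mean2_le:
  "mean2 n \<le> real m * real m + (\<integral>\<omega>. hit2_tail m (S 0 \<omega>) \<partial>M)
     + real n * measure_pmf.expectation (kernel N a) (hit2_tail m)"
proof -
  let ?\<epsilon> = "measure_pmf.expectation (kernel N a) (hit2_tail m)"
  let ?e = "\<lambda>n. \<integral>\<omega>. hit2_tail m (S n \<omega>) \<partial>M"
  have \<epsilon>: "0 \<le> ?\<epsilon>" by (intro Bochner_Integration.integral_nonneg hit2_tail_nonneg)
  have step: "?e (Suc n) \<le> ?e n + ?\<epsilon>" for n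
  proof -
    have le: "measure_pmf.expectation (kernel N s) (hit2_tail m) \<le> hit2_tail m s + ?\<epsilon>" for s
      using expectation_hit2_tail_le[of s m] \<epsilon> hit2_tail_nonneg[of m s] by (cases "s = a") auto
    have i: "integrable M (\<lambda>\<omega>. measure_pmf.expectation (kernel N (S n \<omega>)) (hit2_tail m))"
    proof (rule Bochner_Integration.integrable_bound)
      show "integrable M (\<lambda>\<omega>. hit2_tail m (S n \<omega>) + ?\<epsilon>)" using integrable_hit2_tail_S by simp
      have "0 \<le> measure_pmf.expectation (kernel N s) (hit2_tail m)" for s
        by (intro Bochner_Integration.integral_nonneg hit2_tail_nonneg)
      then show "AE \<omega> in M. norm (measure_pmf.expectation (kernel N (S n \<omega>)) (hit2_tail m))
          \<le> norm (hit2_tail m (S n \<omega>) + ?\<epsilon>)"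
        using le by (auto intro: order_trans[OF _ abs_ge_self])
    qed (rule measurable_state_function)
    have "?e (Suc n) = (\<integral>\<omega>. measure_pmf.expectation (kernel N (S n \<omega>)) (hit2_tail m) \<partial>M)"
      using i by (intro integral_next_state_nonneg(2)[of "\<lambda>s \<omega>. hit2_tail m s" n] hit2_tail_nonneg integrable_hit2_tail) auto
    also have "\<dots> \<le> (\<integral>\<omega>. hit2_tail m (S n \<omega>) + ?\<epsilon> \<partial>M)"
      using i integrable_hit2_tail_S le by (intro integral_mono) auto
    also have "\<dots> = ?e n + ?\<epsilon>"
      using integrable_hit2_tail_S by (simp add: prob_space)
    finally show ?thesis .
  qed
  have e: "?e n \<le> ?e 0 + real n * ?\<epsilon>"
  proof (induction n)
    case (Suc n)
    then show ?case using step[of n] by (simp add: algebra_simps)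
  qed simp
  have "mean2 n \<le> (\<integral>\<omega>. real m * real m + hit2_tail m (S n \<omega>) \<partial>M)"
    unfolding mean2_def using integrable_hit2_tail_S integrable_hit2_S hit2_le_tail by (intro integral_mono) auto
  also have "\<dots> = real m * real m + ?e n"
    using integrable_hit2_tail_S by (simp add: prob_space)
  finally show ?thesis using e by linarith
qed

lemma mean2_sublinear: "(\<lambda>n. mean2 n / real n) \<longlonglongrightarrow> 0"
proof (rule LIMSEQ_I)
  fix r :: real assume r: "0 < r"
  obtain m where m: "measure_pmf.expectation (kernel N a) (hit2_tail m) < r / 2"
    using order_tendstoD(2)[OF expectation_hit2_tail_LIMSEQ[of a], of "r/2"] r
    by (auto simp: eventually_sequentially)
  let ?c = "real m * real m + (\<integral>\<omega>. hit2_tail m (S 0 \<omega>) \<partial>M)"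
  have "(\<lambda>n. ?c / real n) \<longlonglongrightarrow> 0" by (rule lim_const_over_n)
  from order_tendstoD(2)[OF this, of "r/2"] r obtain n0 where n0: "\<And>n. n0 \<le> n \<Longrightarrow> ?c / real n < r / 2"
    by (auto simp: eventually_sequentially)
  have "norm (mean2 n / real n - 0) < r" if n: "max 1 n0 \<le> n" for n
  proof -
    have "mean2 n / real n \<le> (?c + real n * measure_pmf.expectation (kernel N a) (hit2_tail m)) / real n"
      using mean2_le[of n m] by (intro divide_right_mono) auto
    also have "\<dots> = ?c / real n + measure_pmf.expectation (kernel N a) (hit2_tail m)"
      using n by (simp add: add_divide_distrib)
    also have "\<dots> < r" using n0[of n] n m by linarith
    finally show ?thesis
      using mean1_nonneg[of n] mean1_le_mean2[of n] by (simp add: abs_of_nonneg)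
  qed
  then show "\<exists>no. \<forall>n\<ge>no. norm (mean2 n / real n - 0) < r" by blast
qed

lemma mean1_sublinear: "(\<lambda>n. mean1 n / real n) \<longlonglongrightarrow> 0"
  by (rule Lim_null_comparison[OF _ mean2_sublinear])
    (auto intro!: always_eventually divide_right_mono simp: mean1_nonneg mean1_le_mean2)

end

section \<open>Poisson equation along trajectories with backlogs, and weak duality\<close>

context controlled_network
begin

context
  fixes V c :: real and Q :: "'w \<Rightarrow> nat \<Rightarrow> real"
  assumes V: "0 \<le> V" and Q: "Q \<in> borel_measurable M" and Qc: "AE \<omega> in M. \<forall>j\<in>J. \<bar>Q \<omega> j\<bar> \<le> c"
begin

lemma AE_bound: "AE \<omega> in M. bound V (Q \<omega>) \<le> V * \<delta> + \<delta> * (real (num_queues N) * c)"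
  using Qc by eventually_elim (auto intro: bound_mono[OF V])

lemma integrable_corrector: "integrable M (\<lambda>\<omega>. corrector V (Q \<omega>) (S t \<omega>))"
proof (rule Bochner_Integration.integrable_bound)
  let ?b = "V * \<delta> + \<delta> * (real (num_queues N) * c)"
  show "integrable M (\<lambda>\<omega>. 2 * ?b * hit1 (S t \<omega>))" using integrable_hit1_S by simp
  show "(\<lambda>\<omega>. corrector V (Q \<omega>) (S t \<omega>)) \<in> borel_measurable M"
    by (rule measurable_compose_countable[OF measurable_compose[OF Q measurable_corrector[OF V]] S_measurable])
  show "AE \<omega> in M. norm (corrector V (Q \<omega>) (S t \<omega>)) \<le> norm (2 * ?b * hit1 (S t \<omega>))"
    using AE_bound
  proof eventually_elim
    case (elim \<omega>)
    have "\<bar>corrector V (Q \<omega>) (S t \<omega>)\<bar> \<le> 2 * bound V (Q \<omega>) * hit1 (S t \<omega>)"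
      by (rule corrector_bounded[OF V])
    also have "\<dots> \<le> 2 * ?b * hit1 (S t \<omega>)"
      using elim hit1_nonneg by (intro mult_right_mono mult_left_mono) auto
    finally show ?case unfolding real_norm_def by linarith
  qed
qed

lemma integrable_min_penalty_S: "integrable M (\<lambda>\<omega>. min_penalty V (Q \<omega>) (S t \<omega>))"
proof (rule integrable_const_bound)
  show "(\<lambda>\<omega>. min_penalty V (Q \<omega>) (S t \<omega>)) \<in> borel_measurable M"
    by (rule measurable_compose_countable[OF measurable_compose[OF Q measurable_min_penalty[OF V]] S_measurable])
  show "AE \<omega> in M. norm (min_penalty V (Q \<omega>) (S t \<omega>)) \<le> V * \<delta> + \<delta> * (real (num_queues N) * c)"
    using AE_bound
  proof eventually_elim
    case (elim \<omega>)
    then show ?case using min_penalty_bounded[OF V, of "Q \<omega>" "S t \<omega>"] by simp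
  qed
qed

lemma integrable_dual: "integrable M (\<lambda>\<omega>. dual V (Q \<omega>))"
proof (rule integrable_const_bound)
  show "(\<lambda>\<omega>. dual V (Q \<omega>)) \<in> borel_measurable M"
    by (rule measurable_compose[OF Q measurable_dual[OF V]])
  show "AE \<omega> in M. norm (dual V (Q \<omega>)) \<le> V * \<delta> + \<delta> * (real (num_queues N) * c)"
    using AE_bound
  proof eventually_elim
    case (elim \<omega>)
    then show ?case using dual_bounded[OF V, of "Q \<omega>"] by simp
  qed
qed

text \<open>Q is known at time t, so it is frozen while the state makes one step. It will be the
  current backlog for QLA and a constant multiplier vector for weak duality.\<close>

lemma integral_corrector_next:
  assumes QF: "Q \<in> borel_measurable (F t)"
  shows "(\<integral>\<omega>. corrector V (Q \<omega>) (S (Suc t) \<omega>) \<partial>M)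
    = (\<integral>\<omega>. corrector V (Q \<omega>) (S t \<omega>) \<partial>M) - (\<integral>\<omega>. min_penalty V (Q \<omega>) (S t \<omega>) \<partial>M) + (\<integral>\<omega>. dual V (Q \<omega>) \<partial>M)"
proof -
  let ?b = "V * \<delta> + \<delta> * (real (num_queues N) * c)"
  let ?u = "\<lambda>s \<omega>. corrector V (Q \<omega>) s" and ?w = "\<lambda>s \<omega>. 2 * bound V (Q \<omega>) * hit1 s"
  have Qj: "(\<lambda>\<omega>. Q \<omega> j) \<in> borel_measurable (F t)" for j
    by (rule measurable_compose[OF QF measurable_product_coordinates])
  have bF: "(\<lambda>\<omega>. bound V (Q \<omega>)) \<in> borel_measurable (F t)"
    unfolding bound_def using Qj by measurable
  have bM [measurable]: "(\<lambda>\<omega>. bound V (Q \<omega>)) \<in> borel_measurable M"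
    by (rule measurable_from_subalg[OF sub_algebra bF])
  let ?h = "\<lambda>\<omega>. hit1 (S t \<omega>) - 1 + mean_return * indicator {a} (S t \<omega>)"
  have ih: "integrable M ?h"
    using integrable_hit1_S integrable_visit by auto
  \<comment> \<open>\<open>?h\<close> is the one-step expectation of \<open>hit1\<close>, so it
    inherits nonnegativity despite the -1.\<close>
  have h0: "0 \<le> ?h \<omega>" for \<omega>
    unfolding expectation_hit1_eq[symmetric] by (intro Bochner_Integration.integral_nonneg hit1_nonneg)
  have "(\<integral>\<omega>. ?u (S (Suc t) \<omega>) \<omega> \<partial>M)
      = (\<integral>\<omega>. measure_pmf.expectation (kernel N (S t \<omega>)) (\<lambda>s. ?u s \<omega>) \<partial>M)"
  proof (rule integral_next_state(3)[where w="?w"])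
    show "?u s \<in> borel_measurable (F t)" for s
      by (rule measurable_compose[OF QF measurable_corrector[OF V]])
    show "?w s \<in> borel_measurable (F t)" for s
      using bF by measurable
    show "\<bar>?u s \<omega>\<bar> \<le> ?w s \<omega>" for s \<omega>
      by (rule corrector_bounded[OF V])
    show "integrable (kernel N s) (\<lambda>s'. ?w s' \<omega>)" for s \<omega>
      by (intro integrable_mult_right integrable_hit1)
    show "integrable M (\<lambda>\<omega>. measure_pmf.expectation (kernel N (S t \<omega>)) (\<lambda>s. ?w s \<omega>))"
    proof (rule Bochner_Integration.integrable_bound)
      show "integrable M (\<lambda>\<omega>. 2 * ?b * ?h \<omega>)"
        by (intro integrable_mult_right ih)
      have eq: "measure_pmf.expectation (kernel N (S t \<omega>)) (\<lambda>s. ?w s \<omega>) = 2 * bound V (Q \<omega>) * ?h \<omega>" for \<omega>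
        by (simp add: expectation_hit1_eq)
      show "(\<lambda>\<omega>. measure_pmf.expectation (kernel N (S t \<omega>)) (\<lambda>s. ?w s \<omega>)) \<in> borel_measurable M"
        unfolding eq using borel_measurable_integrable[OF ih] by measurable
      show "AE \<omega> in M. norm (measure_pmf.expectation (kernel N (S t \<omega>)) (\<lambda>s. ?w s \<omega>)) \<le> norm (2 * ?b * ?h \<omega>)"
        using AE_bound
      proof eventually_elim
        case (elim \<omega>)
        then have "0 \<le> 2 * bound V (Q \<omega>) * ?h \<omega>" "2 * bound V (Q \<omega>) * ?h \<omega> \<le> 2 * ?b * ?h \<omega>"
          using h0[of \<omega>] bound_nonneg[OF V, of "Q \<omega>"]
          by (auto intro!: mult_nonneg_nonneg mult_right_mono simp del: mult_le_cancel_right)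
        then show ?case unfolding eq real_norm_def by linarith
      qed
    qed
    show "(\<lambda>\<omega>. measure_pmf.expectation (kernel N (S t \<omega>)) (\<lambda>s. ?u s \<omega>)) \<in> borel_measurable M"
      unfolding expectation_corrector[OF V]
      using integrable_corrector[of t] integrable_min_penalty_S[of t] integrable_dual
      by (intro borel_measurable_add borel_measurable_diff borel_measurable_integrable)
  qed
  then show ?thesis
    unfolding expectation_corrector[OF V]
    using integrable_corrector[of t] integrable_min_penalty_S[of t] integrable_dual by simp
qed

end

lemma AE_abs_le_sum: "AE \<omega> in M. \<forall>j\<in>J. \<bar>q j\<bar> \<le> (\<Sum>j\<in>J. \<bar>q j\<bar>)" for q :: "nat \<Rightarrow> real"
  by (intro AE_I2 ballI member_le_sum) auto

lemma sum_min_penalty_const: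
  assumes V: "0 \<le> V"
  shows "(\<Sum>t<n. \<integral>\<omega>. min_penalty V q (S t \<omega>) \<partial>M)
    = real n * dual V q + (\<integral>\<omega>. corrector V q (S 0 \<omega>) \<partial>M) - (\<integral>\<omega>. corrector V q (S n \<omega>) \<partial>M)"
proof (induction n)
  case (Suc n)
  have "(\<integral>\<omega>. corrector V q (S (Suc n) \<omega>) \<partial>M) = (\<integral>\<omega>. corrector V q (S n \<omega>) \<partial>M)
      - (\<integral>\<omega>. min_penalty V q (S n \<omega>) \<partial>M) + dual V q"
    using integral_corrector_next[where Q="\<lambda>_. q", OF V borel_measurable_const AE_abs_le_sum borel_measurable_const, of n]
    by (simp add: prob_space)
  then show ?case using Suc by (simp add: algebra_simps)
qed simp

definition mean_cost :: "nat \<Rightarrow> real" where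
  "mean_cost t = (\<integral>\<omega>. cost N (S t \<omega>) (x t \<omega>) \<partial>M)"

definition mean_queue :: "nat \<Rightarrow> nat \<Rightarrow> real" where
  "mean_queue j t = (\<integral>\<omega>. queue N j (\<lambda>t. S t \<omega>) (\<lambda>t. x t \<omega>) t \<partial>M)"

lemma mean_queue_nonneg: "j \<in> J \<Longrightarrow> 0 \<le> mean_queue j t"
  unfolding mean_queue_def
proof (rule integral_nonneg_AE)
  show "AE \<omega> in M. 0 \<le> queue N j (\<lambda>t. S t \<omega>) (\<lambda>t. x t \<omega>) t" if "j \<in> J"
    using AE_backlog[of t] by eventually_elim (metis backlog_def that)
qed

text \<open>Weak duality: a queue dominates its accumulated net arrivals, so the constraint violation of
  an arbitrary policy is paid for by the final backlog.\<close>

lemma dual_lower_bound: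
  assumes V: "0 \<le> V" and q: "\<And>j. j \<in> J \<Longrightarrow> 0 \<le> q j"
  shows "real n * dual V q - 2 * bound V q * (mean1 0 + mean1 n)
     \<le> V * (\<Sum>t<n. mean_cost t) + (\<Sum>j\<in>J. q j * mean_queue j n)"
proof -
  \<comment> \<open>The chosen action competes in the infimum, and for q >= 0 each net arrival may
    be replaced by the queue increment, which telescopes from the empty queue.\<close>
  have step: "(\<integral>\<omega>. min_penalty V q (S t \<omega>) \<partial>M)
      \<le> V * mean_cost t + (\<Sum>j\<in>J. q j * (mean_queue j (Suc t) - mean_queue j t))" for t
  proof -
    have iq: "integrable M (\<lambda>\<omega>. \<Sum>j\<in>J. q j * (queue N j (\<lambda>t. S t \<omega>) (\<lambda>t. x t \<omega>) (Suc t)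
        - queue N j (\<lambda>t. S t \<omega>) (\<lambda>t. x t \<omega>) t))"
      by (intro Bochner_Integration.integrable_sum integrable_mult_right Bochner_Integration.integrable_diff integrable_queue)
    have "(\<integral>\<omega>. min_penalty V q (S t \<omega>) \<partial>M) \<le> (\<integral>\<omega>. V * cost N (S t \<omega>) (x t \<omega>)
        + (\<Sum>j\<in>J. q j * (queue N j (\<lambda>t. S t \<omega>) (\<lambda>t. x t \<omega>) (Suc t) - queue N j (\<lambda>t. S t \<omega>) (\<lambda>t. x t \<omega>) t)) \<partial>M)"
    proof (rule integral_mono_AE)
      show "integrable M (\<lambda>\<omega>. min_penalty V q (S t \<omega>))"
        by (rule integrable_min_penalty_S[where Q="\<lambda>_. q", OF V borel_measurable_const AE_abs_le_sum])
      show "AE \<omega> in M. min_penalty V q (S t \<omega>) \<le> V * cost N (S t \<omega>) (x t \<omega>)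
        + (\<Sum>j\<in>J. q j * (queue N j (\<lambda>t. S t \<omega>) (\<lambda>t. x t \<omega>) (Suc t) - queue N j (\<lambda>t. S t \<omega>) (\<lambda>t. x t \<omega>) t))"
        using AE_feasible
      proof eventually_elim
        case (elim \<omega>)
        then have f: "\<And>\<tau>. x \<tau> \<omega> \<in> actions N (S \<tau> \<omega>)" by blast
        have "(\<Sum>j\<in>J. q j * (arrival N j (S t \<omega>) (x t \<omega>) - service N j (S t \<omega>) (x t \<omega>)))
          \<le> (\<Sum>j\<in>J. q j * (queue N j (\<lambda>t. S t \<omega>) (\<lambda>t. x t \<omega>) (Suc t) - queue N j (\<lambda>t. S t \<omega>) (\<lambda>t. x t \<omega>) t))"
        proof (intro sum_mono mult_left_mono q)
          fix j assume "j \<in> J"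
          from queue_step(2)[of "\<lambda>t. x t \<omega>" "\<lambda>t. S t \<omega>", OF f this, of t]
          show "arrival N j (S t \<omega>) (x t \<omega>) - service N j (S t \<omega>) (x t \<omega>)
            \<le> queue N j (\<lambda>t. S t \<omega>) (\<lambda>t. x t \<omega>) (Suc t) - queue N j (\<lambda>t. S t \<omega>) (\<lambda>t. x t \<omega>) t"
            by linarith
        qed
        then show ?case
          using min_penalty_le[OF V f[of t], of q] unfolding penalty_def by linarith
      qed
    qed (intro Bochner_Integration.integrable_add integrable_mult_right integrable_cost iq)
    also have "\<dots> = V * mean_cost t + (\<Sum>j\<in>J. q j * (mean_queue j (Suc t) - mean_queue j t))"
    proof -
      have "(\<integral>\<omega>. (\<Sum>j\<in>J. q j * (queue N j (\<lambda>t. S t \<omega>) (\<lambda>t. x t \<omega>) (Suc t) - queue N j (\<lambda>t. S t \<omega>) (\<lambda>t. x t \<omega>) t)) \<partial>M)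
          = (\<Sum>j\<in>J. \<integral>\<omega>. q j * (queue N j (\<lambda>t. S t \<omega>) (\<lambda>t. x t \<omega>) (Suc t) - queue N j (\<lambda>t. S t \<omega>) (\<lambda>t. x t \<omega>) t) \<partial>M)"
        by (intro Bochner_Integration.integral_sum integrable_mult_right Bochner_Integration.integrable_diff integrable_queue)
      also have "\<dots> = (\<Sum>j\<in>J. q j * (mean_queue j (Suc t) - mean_queue j t))"
      proof (rule sum.cong[OF refl])
        fix j assume j: "j \<in> J"
        show "(\<integral>\<omega>. q j * (queue N j (\<lambda>t. S t \<omega>) (\<lambda>t. x t \<omega>) (Suc t) - queue N j (\<lambda>t. S t \<omega>) (\<lambda>t. x t \<omega>) t) \<partial>M)
            = q j * (mean_queue j (Suc t) - mean_queue j t)"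
          unfolding mean_queue_def integral_mult_right_zero
          by (rule arg_cong[where f="\<lambda>y. q j * y"], rule Bochner_Integration.integral_diff) (rule integrable_queue[OF j])+
      qed
      finally show ?thesis
        using Bochner_Integration.integral_add[OF integrable_mult_right[OF integrable_cost, of V] iq]
        unfolding mean_cost_def integral_mult_right_zero by (simp only:)
    qed
    finally show ?thesis .
  qed
  have "(\<Sum>t<n. \<integral>\<omega>. min_penalty V q (S t \<omega>) \<partial>M)
      \<le> (\<Sum>t<n. V * mean_cost t + (\<Sum>j\<in>J. q j * (mean_queue j (Suc t) - mean_queue j t)))"
    by (intro sum_mono step)
  also have "\<dots> = V * (\<Sum>t<n. mean_cost t) + (\<Sum>j\<in>J. q j * mean_queue j n)"
  proof (induction n)
    case 0
    show ?case by (simp add: mean_queue_def)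
  next
    case (Suc n)
    have "(\<Sum>j\<in>J. q j * (mean_queue j (Suc n) - mean_queue j n))
        = (\<Sum>j\<in>J. q j * mean_queue j (Suc n)) - (\<Sum>j\<in>J. q j * mean_queue j n)"
      by (simp only: right_diff_distrib sum_subtractf)
    with Suc show ?case
      unfolding sum.lessThan_Suc distrib_left by linarith
  qed
  finally have "real n * dual V q + (\<integral>\<omega>. corrector V q (S 0 \<omega>) \<partial>M) - (\<integral>\<omega>. corrector V q (S n \<omega>) \<partial>M)
      \<le> V * (\<Sum>t<n. mean_cost t) + (\<Sum>j\<in>J. q j * mean_queue j n)"
    unfolding sum_min_penalty_const[OF V] .
  moreover have "\<bar>\<integral>\<omega>. corrector V q (S t \<omega>) \<partial>M\<bar> \<le> 2 * bound V q * mean1 t" for t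
  proof -
    have "\<bar>\<integral>\<omega>. corrector V q (S t \<omega>) \<partial>M\<bar> \<le> (\<integral>\<omega>. \<bar>corrector V q (S t \<omega>)\<bar> \<partial>M)"
      by (rule integral_abs_bound)
    also have "\<dots> \<le> (\<integral>\<omega>. 2 * bound V q * hit1 (S t \<omega>) \<partial>M)"
      using integrable_corrector[where Q="\<lambda>_. q", OF V borel_measurable_const AE_abs_le_sum, of t] integrable_hit1_S corrector_bounded[OF V]
      by (intro integral_mono) auto
    finally show ?thesis by (simp add: mean1_def)
  qed
  note this[of 0] this[of n]
  ultimately show ?thesis unfolding distrib_left by linarith
qed

end

section \<open>Time averages\<close>

lemma time_avg_le:
  assumes le: "\<And>n. (\<Sum>t<n. u t) \<le> real n * c + g n" and g: "(\<lambda>n. g n / real n) \<longlonglongrightarrow> 0"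
  shows "time_avg u \<le> ereal c"
proof -
  have "(\<lambda>n. ereal (c + g n / real n)) \<longlonglongrightarrow> ereal (c + 0)"
    using g by (intro tendsto_intros)
  then have lim: "limsup (\<lambda>n. ereal (c + g n / real n)) = ereal c"
    by (intro lim_imp_Limsup) auto
  have "time_avg u \<le> limsup (\<lambda>n. ereal (c + g n / real n))"
    unfolding time_avg_def
  proof (rule Limsup_mono)
    show "\<forall>\<^sub>F n in sequentially. ereal ((\<Sum>t<n. u t) / real n) \<le> ereal (c + g n / real n)"
      using eventually_gt_at_top[of 0]
    proof eventually_elim
      case (elim n)
      have "(\<Sum>t<n. u t) / real n \<le> (real n * c + g n) / real n"
        using le[of n] by (intro divide_right_mono) auto
      also have "\<dots> = c + g n / real n"
        using elim by (simp add: add_divide_distrib)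
      finally show ?case by simp
    qed
  qed
  with lim show ?thesis by simp
qed

lemma time_avg_less_eventually:
  assumes "time_avg u < ereal c"
  shows "\<forall>\<^sub>F n in sequentially. (\<Sum>t<n. u t) < c * real n"
  using Limsup_lessD[OF assms[unfolded time_avg_def]] eventually_gt_at_top[of 0]
  by eventually_elim (simp add: divide_less_eq)

text \<open>If b n >= \<epsilon> n from some point on, the block from m to 2m alone sums to at least
  \<epsilon> m^2, which exceeds K * 2m for large m.\<close>

lemma not_linear_growth:
  fixes b :: "nat \<Rightarrow> real"
  assumes b: "\<And>n. 0 \<le> b n" and \<epsilon>: "0 < \<epsilon>"
    and "\<forall>\<^sub>F n in sequentially. \<epsilon> * real n \<le> b n"
    and "\<forall>\<^sub>F n in sequentially. (\<Sum>t<n. b t) \<le> K * real n"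
  shows False
proof -
  obtain n0 where n0: "\<And>n. n0 \<le> n \<Longrightarrow> \<epsilon> * real n \<le> b n" "\<And>n. n0 \<le> n \<Longrightarrow> (\<Sum>t<n. b t) \<le> K * real n"
    using eventually_conj[OF assms(3,4)] unfolding eventually_sequentially by blast
  obtain k :: nat where k: "2 * K / \<epsilon> < real k" using reals_Archimedean2 by blast
  define m where "m = max (max n0 1) k"
  have m: "n0 \<le> m" "1 \<le> m" "2 * K < \<epsilon> * real m"
  proof -
    show "n0 \<le> m" "1 \<le> m" by (auto simp: m_def)
    have "2 * K / \<epsilon> < real m" using k by (simp add: m_def)
    then show "2 * K < \<epsilon> * real m" using \<epsilon> by (simp add: divide_less_eq mult.commute)
  qed
  have "real m * (\<epsilon> * real m) = (\<Sum>t\<in>{m..<2*m}. \<epsilon> * real m)" by simp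
  also have "\<dots> \<le> (\<Sum>t\<in>{m..<2*m}. b t)"
  proof (rule sum_mono)
    fix t assume t: "t \<in> {m..<2*m}"
    then have "\<epsilon> * real m \<le> \<epsilon> * real t" using \<epsilon> by simp
    also have "\<dots> \<le> b t" using n0(1)[of t] m t by simp
    finally show "\<epsilon> * real m \<le> b t" .
  qed
  also have "\<dots> \<le> (\<Sum>t<2*m. b t)" using b by (intro sum_mono2) auto
  also have "\<dots> \<le> K * real (2 * m)" using m by (intro n0(2)) simp
  finally have "real m * (\<epsilon> * real m) \<le> real m * (2 * K)" by (simp add: mult_ac)
  then show False using m by simp
qed

context square_integrable_hitting
begin

lemma half_D_nonneg: "0 \<le> half_D"
proof -
  have "surv K a m a \<le> real (Suc m) * surv K a m a" for m
    using mult_right_mono[of 1 "real (Suc m)" "surv K a m a"] surv_bounds(1)[of K a m a] by simp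
  then have "(\<Sum>m. surv K a m a) \<le> (\<Sum>m. real (Suc m) * surv K a m a)"
    by (intro suminf_le summable_surv summable_surv2)
  then show ?thesis by (simp add: half_D_def potential_def)
qed

end

section \<open>Duality bound for stable policies and drift analysis of QLA\<close>

context controlled_network
begin

lemma avg_cost_eq: "avg_cost N M S x = time_avg mean_cost"
  by (simp add: avg_cost_def mean_cost_def[abs_def])

lemma avg_backlog_eq: "avg_backlog N M S x = time_avg (\<lambda>t. \<Sum>j\<in>J. mean_queue j t)"
  by (simp add: avg_backlog_def mean_queue_def[abs_def])

text \<open>An average cost below this value would, through weak duality, force the q-weighted mean
  backlog to grow linearly, which stability forbids.\<close>

lemma dual_le_avg_cost:
  assumes stable: "avg_backlog N M S x < \<infinity>" and V: "0 < V" and q: "\<And>j. j \<in> J \<Longrightarrow> 0 \<le> q j"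
  shows "ereal (dual V q / V) \<le> avg_cost N M S x"
proof (rule ccontr)
  assume "\<not> ?thesis"
  then have "time_avg mean_cost < ereal (dual V q / V)" by (simp add: avg_cost_eq)
  then obtain r where r: "time_avg mean_cost < ereal r" "ereal r < ereal (dual V q / V)"
    using ereal_dense2 by blast
  \<comment> \<open>Half of the gap is spent on the corrector terms at times 0 and n, which are
    o(n); the other half remains as the growth rate.\<close>
  define \<epsilon> where "\<epsilon> = (dual V q - V * r) / 2"
  have \<epsilon>: "0 < \<epsilon>" using r(2) V by (simp add: \<epsilon>_def less_divide_eq mult.commute)
  let ?b = "\<lambda>n. \<Sum>j\<in>J. q j * mean_queue j n"
  have b: "0 \<le> ?b n" for n using q mean_queue_nonneg by (intro sum_nonneg mult_nonneg_nonneg) auto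
  have "(\<lambda>n. 2 * bound V q * (mean1 0 / real n + mean1 n / real n)) \<longlonglongrightarrow> 2 * bound V q * (0 + 0)"
    by (intro tendsto_intros mean1_sublinear lim_const_over_n)
  then have "\<forall>\<^sub>F n in sequentially. 2 * bound V q * (mean1 0 / real n + mean1 n / real n) < \<epsilon>"
    using \<epsilon> by (intro order_tendstoD(2)) auto
  then have low: "\<forall>\<^sub>F n in sequentially. \<epsilon> * real n \<le> ?b n"
    using time_avg_less_eventually[OF r(1)] eventually_gt_at_top[of 0]
  proof eventually_elim
    case (elim n)
    have "2 * bound V q * (mean1 0 + mean1 n) = real n * (2 * bound V q * (mean1 0 / real n + mean1 n / real n))"
      using elim(3) by (simp add: field_simps)
    also have "\<dots> \<le> real n * \<epsilon>" using elim(1) by (intro mult_left_mono) auto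
    finally have "2 * bound V q * (mean1 0 + mean1 n) \<le> real n * \<epsilon>" .
    moreover have "V * (\<Sum>t<n. mean_cost t) \<le> V * (r * real n)"
      using elim(2) V by (intro mult_left_mono) auto
    moreover have "real n * dual V q = real n * \<epsilon> + real n * \<epsilon> + V * (r * real n)"
      by (simp add: \<epsilon>_def field_simps)
    ultimately show ?case
      using dual_lower_bound[where n=n and q=q, OF less_imp_le[OF V] q] by (simp add: mult.commute)
  qed
  obtain K where K: "time_avg (\<lambda>t. \<Sum>j\<in>J. mean_queue j t) < ereal K"
    using stable ereal_dense2[of "avg_backlog N M S x" \<infinity>] unfolding avg_backlog_eq by blast
  have "\<forall>\<^sub>F n in sequentially. (\<Sum>t<n. ?b t) \<le> (\<Sum>j\<in>J. q j) * K * real n"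
    using time_avg_less_eventually[OF K]
  proof eventually_elim
    case (elim n)
    \<comment> \<open>Each weight is at most the sum of all weights, so the weighted backlog is
      controlled by the total backlog.\<close>
    have "(\<Sum>t<n. ?b t) \<le> (\<Sum>t<n. \<Sum>j\<in>J. (\<Sum>j\<in>J. q j) * mean_queue j t)"
      using q mean_queue_nonneg by (intro sum_mono mult_right_mono member_le_sum) auto
    also have "\<dots> = (\<Sum>j\<in>J. q j) * (\<Sum>t<n. \<Sum>j\<in>J. mean_queue j t)"
      by (simp only: sum_distrib_left)
    also have "\<dots> \<le> (\<Sum>j\<in>J. q j) * (K * real n)"
      using elim q by (intro mult_left_mono sum_nonneg) auto
    finally show ?case by (simp add: mult.assoc)
  qed
  from not_linear_growth[OF b \<epsilon> low this] show False .
qed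

definition energy :: "nat \<Rightarrow> 'w \<Rightarrow> real" where
  "energy t \<omega> = (\<Sum>j\<in>J. (queue N j (\<lambda>t. S t \<omega>) (\<lambda>t. x t \<omega>) t)\<^sup>2) / 2"

lemma integrable_energy: "integrable M (energy t)"
  unfolding energy_def[abs_def]
  by (intro integrable_divide Bochner_Integration.integrable_sum integrable_queue_square)

abbreviation Bsq :: real where "Bsq \<equiv> real (num_queues N) * \<delta>\<^sup>2"

context
  fixes V :: real
  assumes V: "0 \<le> V" and QLA: "QLA_policy N V s0 M F S x"
begin

lemma AE_QLA_minimizes:
  "AE \<omega> in M. penalty V (backlog t \<omega>) (S t \<omega>) (x t \<omega>) = min_penalty V (backlog t \<omega>) (S t \<omega>)"
  using QLA_policy.action_maximizes[OF QLA, of t]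
proof eventually_elim
  case (elim \<omega>)
  let ?q = "\<lambda>j. queue N j (\<lambda>t. S t \<omega>) (\<lambda>t. x t \<omega>) t"
  have eq: "penalty V (backlog t \<omega>) (S t \<omega>) y = - QLA_objective N V ?q (S t \<omega>) y" for y
  proof -
    have "(\<Sum>j\<in>J. backlog t \<omega> j * (arrival N j (S t \<omega>) y - service N j (S t \<omega>) y))
        = (\<Sum>j\<in>J. - (?q j * (service N j (S t \<omega>) y - arrival N j (S t \<omega>) y)))"
      by (rule sum.cong) (simp_all add: backlog_def algebra_simps)
    then show ?thesis by (simp add: penalty_def QLA_objective_def sum_negf)
  qed
  have max: "QLA_objective N V ?q (S t \<omega>) y \<le> QLA_objective N V ?q (S t \<omega>) (x t \<omega>)"
      if "y \<in> actions N (S t \<omega>)" for y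
    using elim that by (auto simp: is_arg_max_def not_less)
  have x: "x t \<omega> \<in> actions N (S t \<omega>)" using elim by (simp add: is_arg_max_def)
  show ?case
  proof (rule antisym)
    show "penalty V (backlog t \<omega>) (S t \<omega>) (x t \<omega>) \<le> min_penalty V (backlog t \<omega>) (S t \<omega>)"
      unfolding min_penalty_def eq using max by (intro cINF_greatest actions_nonempty) auto
  qed (rule min_penalty_le[OF V x])
qed

text \<open>QLA attains the infimum at the current backlog, so the cross term of the quadratic drift
  together with V times the cost is exactly \<open>min_penalty\<close>. The 2\<delta>^2 per queue
  becomes \<open>Bsq\<close> by the factor 1/2 in the energy.\<close>

lemma energy_drift:
  "(\<integral>\<omega>. energy (Suc t) \<omega> \<partial>M) + V * mean_cost t
    \<le> (\<integral>\<omega>. energy t \<omega> \<partial>M) + Bsq + (\<integral>\<omega>. min_penalty V (backlog t \<omega>) (S t \<omega>) \<partial>M)"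
proof -
  note im = integrable_min_penalty_S[OF V backlog_measurable AE_backlog_abs, of t t]
  have "(\<integral>\<omega>. energy (Suc t) \<omega> + V * cost N (S t \<omega>) (x t \<omega>) \<partial>M)
      \<le> (\<integral>\<omega>. energy t \<omega> + Bsq + min_penalty V (backlog t \<omega>) (S t \<omega>) \<partial>M)"
  proof (rule integral_mono_AE)
    show "AE \<omega> in M. energy (Suc t) \<omega> + V * cost N (S t \<omega>) (x t \<omega>)
        \<le> energy t \<omega> + Bsq + min_penalty V (backlog t \<omega>) (S t \<omega>)"
      using AE_feasible AE_QLA_minimizes[of t]
    proof eventually_elim
      case (elim \<omega>)
      then have f: "\<And>\<tau>. x \<tau> \<omega> \<in> actions N (S \<tau> \<omega>)" by blast
      let ?q = "\<lambda>j. queue N j (\<lambda>t. S t \<omega>) (\<lambda>t. x t \<omega>)"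
      let ?d = "\<lambda>j. arrival N j (S t \<omega>) (x t \<omega>) - service N j (S t \<omega>) (x t \<omega>)"
      have "(\<Sum>j\<in>J. (?q j (Suc t))\<^sup>2) \<le> (\<Sum>j\<in>J. (?q j t)\<^sup>2 + 2 * \<delta>\<^sup>2 + 2 * (?q j t * ?d j))"
        by (intro sum_mono queue_step(3)[of "\<lambda>t. x t \<omega>" "\<lambda>t. S t \<omega>", OF f])
      also have "\<dots> = (\<Sum>j\<in>J. (?q j t)\<^sup>2) + 2 * Bsq + 2 * (\<Sum>j\<in>J. ?q j t * ?d j)"
        by (simp add: sum.distrib sum_distrib_left)
      also have "(\<Sum>j\<in>J. ?q j t * ?d j) = (\<Sum>j\<in>J. backlog t \<omega> j * ?d j)"
        by (rule sum.cong) (simp_all add: backlog_def)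
      finally have "energy (Suc t) \<omega> \<le> energy t \<omega> + Bsq + (\<Sum>j\<in>J. backlog t \<omega> j * ?d j)"
        unfolding energy_def by linarith
      then show ?case using elim(2) unfolding penalty_def by linarith
    qed
  qed (use integrable_energy integrable_cost im in auto)
  then show ?thesis
    using integrable_energy integrable_cost[of t] im by (simp add: mean_cost_def prob_space)
qed

text \<open>Each queue moves by at most \<delta>, so the Lipschitz bound 2\<delta>
  \<open>hit1\<close> costs 2 \<open>Bsq\<close> \<open>hit1\<close>, evaluated at the new
  state.\<close>

lemma corrector_backlog_step:
  "(\<integral>\<omega>. corrector V (backlog (Suc t) \<omega>) (S (Suc t) \<omega>) \<partial>M)
    \<le> (\<integral>\<omega>. corrector V (backlog t \<omega>) (S (Suc t) \<omega>) \<partial>M) + 2 * Bsq * mean1 (Suc t)"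
proof -
  note i1 = integrable_corrector[OF V backlog_measurable AE_backlog_abs, of "Suc t" "Suc t"]
  note i2 = integrable_corrector[OF V backlog_measurable AE_backlog_abs, of t "Suc t"]
  have "(\<integral>\<omega>. corrector V (backlog (Suc t) \<omega>) (S (Suc t) \<omega>) \<partial>M)
    \<le> (\<integral>\<omega>. corrector V (backlog t \<omega>) (S (Suc t) \<omega>) + 2 * Bsq * hit1 (S (Suc t) \<omega>) \<partial>M)"
  proof (rule integral_mono_AE)
    show "AE \<omega> in M. corrector V (backlog (Suc t) \<omega>) (S (Suc t) \<omega>)
        \<le> corrector V (backlog t \<omega>) (S (Suc t) \<omega>) + 2 * Bsq * hit1 (S (Suc t) \<omega>)"
      using AE_feasible
    proof eventually_elim
      case (elim \<omega>)
      then have f: "\<And>\<tau>. x \<tau> \<omega> \<in> actions N (S \<tau> \<omega>)" by blast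
      have "(\<Sum>j\<in>J. \<bar>backlog (Suc t) \<omega> j - backlog t \<omega> j\<bar>) \<le> (\<Sum>j\<in>J. \<delta>)"
        using queue_step(1)[of "\<lambda>t. x t \<omega>" "\<lambda>t. S t \<omega>", OF f]
        by (intro sum_mono) (simp add: backlog_def del: queue.simps)
      then have "2 * \<delta> * hit1 (S (Suc t) \<omega>) * (\<Sum>j\<in>J. \<bar>backlog (Suc t) \<omega> j - backlog t \<omega> j\<bar>)
          \<le> 2 * \<delta> * hit1 (S (Suc t) \<omega>) * (real (num_queues N) * \<delta>)"
        using \<delta>_pos hit1_nonneg[of "S (Suc t) \<omega>"] by (intro mult_left_mono) auto
      then show ?case
        using corrector_Lipschitz[OF V, of "backlog (Suc t) \<omega>" "S (Suc t) \<omega>" "backlog t \<omega>"]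
        by (simp add: power2_eq_square mult_ac)
    qed
  qed (use i1 i2 integrable_hit1_S in auto)
  then show ?thesis
    using i2 integrable_hit1_S[of "Suc t"] by (simp add: mean1_def)
qed

text \<open>In the sum of energy drift, Poisson equation and backlog step, the
  \<open>min_penalty\<close> of each slot cancels against \<open>dual\<close>, while energy and
  corrector telescope.\<close>

lemma QLA_sum:
  "(\<integral>\<omega>. energy n \<omega> \<partial>M) + V * (\<Sum>t<n. mean_cost t) + (\<integral>\<omega>. corrector V (backlog n \<omega>) (S n \<omega>) \<partial>M)
    \<le> real n * Bsq + (\<Sum>t<n. \<integral>\<omega>. dual V (backlog t \<omega>) \<partial>M)
      + (\<integral>\<omega>. corrector V (backlog 0 \<omega>) (S 0 \<omega>) \<partial>M) + 2 * Bsq * (\<Sum>t<n. mean1 (Suc t))"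
proof (induction n)
  case 0
  show ?case by (simp add: energy_def)
next
  case (Suc n)
  have "V * (\<Sum>t<Suc n. mean_cost t) = V * (\<Sum>t<n. mean_cost t) + V * mean_cost n"
    "2 * Bsq * (\<Sum>t<Suc n. mean1 (Suc t)) = 2 * Bsq * (\<Sum>t<n. mean1 (Suc t)) + 2 * Bsq * mean1 (Suc n)"
    "real (Suc n) * Bsq = real n * Bsq + Bsq"
    by (simp_all add: distrib_left distrib_right)
  then show ?case
    using Suc energy_drift[of n] corrector_backlog_step[of n]
      integral_corrector_next[OF V backlog_measurable AE_backlog_abs backlog_measurable_F, of n]
    unfolding sum.lessThan_Suc[of "\<lambda>t. \<integral>\<omega>. dual V (backlog t \<omega>) \<partial>M"] by linarith
qed

text \<open>The quadratic energy absorbs the corrector at the final time, which is linear in the backlog.\<close>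

lemma energy_absorbs_corrector:
  "- (\<integral>\<omega>. corrector V (backlog n \<omega>) (S n \<omega>) \<partial>M) - (\<integral>\<omega>. energy n \<omega> \<partial>M)
    \<le> 2 * V * \<delta> * mean1 n + 4 * Bsq * mean2 n"
proof -
  note i1 = integrable_corrector[OF V backlog_measurable AE_backlog_abs, of n n]
  have "(\<integral>\<omega>. - corrector V (backlog n \<omega>) (S n \<omega>) - energy n \<omega> \<partial>M)
      \<le> (\<integral>\<omega>. 2 * V * \<delta> * hit1 (S n \<omega>) + 4 * Bsq * hit2 (S n \<omega>) \<partial>M)"
  proof (rule integral_mono)
    fix \<omega>
    let ?W = "hit1 (S n \<omega>)"
    have "- corrector V (backlog n \<omega>) (S n \<omega>) \<le> 2 * bound V (backlog n \<omega>) * ?W"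
      using corrector_bounded[OF V, of "backlog n \<omega>" "S n \<omega>"] by linarith
    also have "\<dots> = 2 * V * \<delta> * ?W + (\<Sum>j\<in>J. 2 * \<delta> * ?W * \<bar>backlog n \<omega> j\<bar>)"
      unfolding bound_def by (simp only: sum_distrib_left[symmetric]) (simp add: algebra_simps)
    also have "(\<Sum>j\<in>J. 2 * \<delta> * ?W * \<bar>backlog n \<omega> j\<bar>)
        \<le> (\<Sum>j\<in>J. (queue N j (\<lambda>t. S t \<omega>) (\<lambda>t. x t \<omega>) n)\<^sup>2 / 2 + 2 * \<delta>\<^sup>2 * ?W\<^sup>2)"
    proof (rule sum_mono)
      fix j assume "j \<in> J"
      then have "(queue N j (\<lambda>t. S t \<omega>) (\<lambda>t. x t \<omega>) n)\<^sup>2 = \<bar>backlog n \<omega> j\<bar>\<^sup>2"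
        by (simp add: backlog_def)
      moreover have "0 \<le> (\<bar>backlog n \<omega> j\<bar> - 2 * \<delta> * ?W)\<^sup>2" by simp
      ultimately show "2 * \<delta> * ?W * \<bar>backlog n \<omega> j\<bar>
          \<le> (queue N j (\<lambda>t. S t \<omega>) (\<lambda>t. x t \<omega>) n)\<^sup>2 / 2 + 2 * \<delta>\<^sup>2 * ?W\<^sup>2"
        by (simp only: power2_diff) (simp add: power2_eq_square algebra_simps)
    qed
    also have "\<dots> = energy n \<omega> + 2 * Bsq * ?W\<^sup>2"
      unfolding energy_def by (simp add: sum.distrib sum_divide_distrib)
    \<comment> \<open>The squared mean is traded for \<open>hit2\<close>, whose expectation is known
      to be o(n).\<close>
    also have "2 * Bsq * ?W\<^sup>2 \<le> 2 * Bsq * (2 * hit2 (S n \<omega>))"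
      by (intro mult_left_mono hit1_square_le) auto
    finally show "- corrector V (backlog n \<omega>) (S n \<omega>) - energy n \<omega>
        \<le> 2 * V * \<delta> * ?W + 4 * Bsq * hit2 (S n \<omega>)" by simp
  qed (use i1 integrable_energy integrable_hit1_S integrable_hit2_S in auto)
  then show ?thesis
    using i1 integrable_energy[of n] integrable_hit1_S[of n] integrable_hit2_S[of n]
    by (simp add: mean1_def mean2_def)
qed

text \<open>The 1 comes from the energy drift, the rest from charging 2 \<open>hit1\<close> per slot
  at its time average D/(2 T1).\<close>

definition overhead :: real where
  "overhead = Bsq * (1 + 2 * (half_D / mean_return))"

text \<open>Collects the boundary terms. The +1 beside \<open>half_D / mean_return\<close> stems
  from summing \<open>mean1\<close> over times 1 to n instead of 0 to n-1.\<close>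

definition remainder :: "nat \<Rightarrow> real" where
  "remainder n = (\<integral>\<omega>. corrector V (backlog 0 \<omega>) (S 0 \<omega>) \<partial>M) + 2 * V * \<delta> * mean1 n + 4 * Bsq * mean2 n
     + 2 * Bsq * (mean2 0 - mean2 n + (half_D / mean_return + 1) * (mean1 n - mean1 0))"

lemma remainder_sublinear: "(\<lambda>n. remainder n / real n) \<longlonglongrightarrow> 0"
proof -
  let ?c = "\<integral>\<omega>. corrector V (backlog 0 \<omega>) (S 0 \<omega>) \<partial>M"
  have "(\<lambda>n. ?c / real n + 2 * V * \<delta> * (mean1 n / real n) + 4 * Bsq * (mean2 n / real n)
     + 2 * Bsq * (mean2 0 / real n - mean2 n / real n + (half_D / mean_return + 1) * (mean1 n / real n - mean1 0 / real n)))
     \<longlonglongrightarrow> 0 + 2 * V * \<delta> * 0 + 4 * Bsq * 0 + 2 * Bsq * (0 - 0 + (half_D / mean_return + 1) * (0 - 0))"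
    by (intro tendsto_intros mean1_sublinear mean2_sublinear lim_const_over_n)
  then show ?thesis
    unfolding remainder_def by (simp add: divide_inverse algebra_simps)
qed

lemma QLA_cost_sum:
  "V * (\<Sum>t<n. mean_cost t)
    \<le> real n * overhead + (\<Sum>t<n. \<integral>\<omega>. dual V (backlog t \<omega>) \<partial>M) + remainder n"
proof -
  define k where "k = half_D / mean_return"
  have "(\<Sum>t<n. mean1 (Suc t)) = (\<Sum>t<n. mean1 t) + mean1 n - mean1 0"
    by (induction n) auto
  then have "2 * Bsq * (\<Sum>t<n. mean1 (Suc t))
      = 2 * Bsq * (mean2 0 - mean2 n + half_D / mean_return * (real n + mean1 n - mean1 0) + mean1 n - mean1 0)"
    unfolding sum_mean1 by simp
  also have "real n * Bsq + \<dots> = real n * overhead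
      + 2 * Bsq * (mean2 0 - mean2 n + (half_D / mean_return + 1) * (mean1 n - mean1 0))"
    unfolding overhead_def k_def[symmetric] by (simp add: algebra_simps)
  finally show ?thesis
    using QLA_sum[of n] energy_absorbs_corrector[of n] unfolding remainder_def by linarith
qed

lemma QLA_avg_cost_le:
  assumes "0 < V" and d: "\<And>q. (\<And>j. j \<in> J \<Longrightarrow> 0 \<le> q j) \<Longrightarrow> dual V q \<le> V * f"
  shows "avg_cost N M S x \<le> ereal (f + overhead / V)"
  unfolding avg_cost_eq
proof (rule time_avg_le)
  show "(\<lambda>n. remainder n / V / real n) \<longlonglongrightarrow> 0"
    using tendsto_divide[OF remainder_sublinear tendsto_const[of V]] assms(1) by (simp add: mult.commute)
  fix n
  have "(\<integral>\<omega>. dual V (backlog t \<omega>) \<partial>M) \<le> V * f" for t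
  proof -
    have "(\<integral>\<omega>. dual V (backlog t \<omega>) \<partial>M) \<le> (\<integral>\<omega>. V * f \<partial>M)"
    proof (rule integral_mono_AE)
      show "AE \<omega> in M. dual V (backlog t \<omega>) \<le> V * f"
        using AE_backlog[of t] by eventually_elim (rule d, blast)
    qed (auto intro: integrable_dual[OF V backlog_measurable AE_backlog_abs])
    then show ?thesis by (simp add: prob_space)
  qed
  then have "(\<Sum>t<n. \<integral>\<omega>. dual V (backlog t \<omega>) \<partial>M) \<le> (\<Sum>t<n. V * f)"
    by (intro sum_mono)
  then have "V * (\<Sum>t<n. mean_cost t) \<le> real n * overhead + real n * (V * f) + remainder n"
    using QLA_cost_sum[of n] by simp
  then show "(\<Sum>t<n. mean_cost t) \<le> real n * (f + overhead / V) + remainder n / V"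
    using assms(1) by (simp add: field_simps)
qed

lemma QLA_avg_backlog_le:
  assumes slack: "slackness N \<pi> \<eta>" and \<eta>: "0 < \<eta>"
  shows "avg_backlog N M S x \<le> ereal ((overhead + V * \<delta>) / \<eta>)"
  unfolding avg_backlog_eq
proof (rule time_avg_le)
  show "(\<lambda>n. remainder n / \<eta> / real n) \<longlonglongrightarrow> 0"
    using tendsto_divide[OF remainder_sublinear tendsto_const[of \<eta>]] \<eta> by (simp add: mult.commute)
  fix n
  \<comment> \<open>By the sign condition the costs lie in an interval of length \<delta>, not
    2\<delta>: c is \<delta> for costs and 0 for rewards. Only this length enters, which gives
    V\<delta> in the bound.\<close>
  obtain c where c: "\<And>s y. y \<in> actions N s \<Longrightarrow> cost N s y \<le> c" "\<And>s y. y \<in> actions N s \<Longrightarrow> c - \<delta> \<le> cost N s y"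
  proof (cases "\<forall>s. \<forall>y\<in>actions N s. 0 \<le> cost N s y")
    case True
    then show ?thesis using that[of \<delta>] cost_bounded by (simp add: abs_le_iff)
  next
    case False
    then have "\<forall>s. \<forall>y\<in>actions N s. cost N s y \<le> 0" using cost_sign by blast
    then show ?thesis using that[of 0] cost_bounded by (simp add: abs_le_iff minus_le_iff)
  qed
  have low: "c - \<delta> \<le> mean_cost t" for t
  proof -
    have "(\<integral>\<omega>. c - \<delta> \<partial>M) \<le> mean_cost t"
      unfolding mean_cost_def
    proof (rule integral_mono_AE)
      show "AE \<omega> in M. c - \<delta> \<le> cost N (S t \<omega>) (x t \<omega>)"
        using action_feasible[of t] by eventually_elim (rule c(2))
    qed (use integrable_cost in auto)
    then show ?thesis by (simp add: prob_space)
  qed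
  have "(\<integral>\<omega>. dual V (backlog t \<omega>) \<partial>M) \<le> V * c - \<eta> * (\<Sum>j\<in>J. mean_queue j t)" for t
  proof -
    let ?q = "\<lambda>j \<omega>. queue N j (\<lambda>t. S t \<omega>) (\<lambda>t. x t \<omega>) t"
    have iq: "integrable M (\<lambda>\<omega>. \<Sum>j\<in>J. ?q j \<omega>)"
      by (intro Bochner_Integration.integrable_sum integrable_queue)
    have "(\<integral>\<omega>. dual V (backlog t \<omega>) \<partial>M) \<le> (\<integral>\<omega>. V * c - \<eta> * (\<Sum>j\<in>J. ?q j \<omega>) \<partial>M)"
    proof (rule integral_mono_AE)
      show "AE \<omega> in M. dual V (backlog t \<omega>) \<le> V * c - \<eta> * (\<Sum>j\<in>J. ?q j \<omega>)"
        using AE_backlog[of t]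
      proof eventually_elim
        case (elim \<omega>)
        then have "dual V (backlog t \<omega>) \<le> V * c - \<eta> * (\<Sum>j\<in>J. backlog t \<omega> j)"
          using c(1) by (intro dual_slackness[OF slack V]) auto
        also have "(\<Sum>j\<in>J. backlog t \<omega> j) = (\<Sum>j\<in>J. ?q j \<omega>)"
          by (rule sum.cong) (simp_all add: backlog_def)
        finally show ?case .
      qed
      show "integrable M (\<lambda>\<omega>. dual V (backlog t \<omega>))"
        by (rule integrable_dual[OF V backlog_measurable AE_backlog_abs])
      show "integrable M (\<lambda>\<omega>. V * c - \<eta> * (\<Sum>j\<in>J. ?q j \<omega>))"
        by (intro Bochner_Integration.integrable_diff integrable_mult_right iq) simp
    qed
    also have "\<dots> = V * c - \<eta> * (\<integral>\<omega>. (\<Sum>j\<in>J. ?q j \<omega>) \<partial>M)"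
      using iq by (simp add: prob_space)
    also have "(\<integral>\<omega>. (\<Sum>j\<in>J. ?q j \<omega>) \<partial>M) = (\<Sum>j\<in>J. mean_queue j t)"
      unfolding mean_queue_def by (intro Bochner_Integration.integral_sum integrable_queue)
    finally show ?thesis .
  qed
  \<comment> \<open>Slackness makes the summed dual values pay \<eta> times the summed backlog, so
    the cost inequality can be solved for the backlog.\<close>
  then have "(\<Sum>t<n. \<integral>\<omega>. dual V (backlog t \<omega>) \<partial>M)
      \<le> (\<Sum>t<n. V * c - \<eta> * (\<Sum>j\<in>J. mean_queue j t))"
    by (intro sum_mono)
  then have "(\<Sum>t<n. \<integral>\<omega>. dual V (backlog t \<omega>) \<partial>M)
      \<le> real n * (V * c) - \<eta> * (\<Sum>t<n. \<Sum>j\<in>J. mean_queue j t)"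
    by (simp add: sum_subtractf sum_distrib_left)
  moreover have "V * (real n * (c - \<delta>)) \<le> V * (\<Sum>t<n. mean_cost t)"
    using sum_mono[where K="{..<n}", OF low] V by (intro mult_left_mono) auto
  ultimately have "\<eta> * (\<Sum>t<n. \<Sum>j\<in>J. mean_queue j t) \<le> real n * (overhead + V * \<delta>) + remainder n"
    using QLA_cost_sum[of n] by (simp add: algebra_simps)
  then have "(\<Sum>t<n. \<Sum>j\<in>J. mean_queue j t) \<le> (real n * (overhead + V * \<delta>) + remainder n) / \<eta>"
    using \<eta> by (simp add: le_divide_eq mult.commute)
  then show "(\<Sum>t<n. \<Sum>j\<in>J. mean_queue j t) \<le> real n * ((overhead + V * \<delta>) / \<eta>) + remainder n / \<eta>"
    unfolding add_divide_distrib[of _ "remainder n"] times_divide_eq_right .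
qed

end

end

section \<open>Comparison with competing policies and the final constants\<close>

theorem theorem2:
  fixes N :: "('s::countable, 'a::topological_space) network"
    and M :: "'w measure"
    and s0 s1 :: 's
    and \<delta> \<eta> V T1 T1sq B C D :: real
  assumes "stochastic_network N \<pi> \<delta>"
    and "\<forall>s. hitting_moment (kernel N) 2 s s1 < \<infinity>"
    and "0 < \<eta>" and "slackness N \<pi> \<eta>"
    and "1 \<le> V" and "QLA_policy N V s0 M F S x"
    and "T1 = enn2real (hitting_moment (kernel N) 1 s1 s1)"
    and "T1sq = enn2real (hitting_moment (kernel N) 2 s1 s1)"
    and "C = T1sq + T1" and "D = T1sq - T1"
    and "B = sqrt (real (num_queues N)) * \<delta>"
  shows "avg_cost N M S x \<le> optimal_cost N s0 + ereal (C * B\<^sup>2 / (V * T1)) \<and>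
         avg_backlog N M S x \<le> ereal ((C * B\<^sup>2 + T1 * V * \<delta>) / \<eta> + D * B\<^sup>2 / 2)"
proof -
  interpret net: stochastic_network N \<pi> \<delta> by fact
  interpret chain: square_integrable_hitting "kernel N" s1
    using assms(2) by (intro square_integrable_hittingI) blast
  interpret potential: network_potential N \<pi> \<delta> s1
  proof
    show "actions N s \<noteq> {}" for s
      using assms(4) unfolding slackness_def by force
  qed
  interpret qla: QLA_policy N V s0 M F S x by fact
  interpret ctl: controlled_network N \<pi> \<delta> s1 s0 M F S x
    by unfold_locales
  have V: "0 < V" "0 \<le> V" using assms(5) by auto
  have T1: "T1 = chain.mean_return" "1 \<le> T1"
    using hitting_moment_1[OF chain.square_integrable_hitting_axioms, of s1] chain.return_time_ge_1[of s1] assms(7) by auto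
  have D: "D = 2 * chain.half_D" "0 \<le> D"
    using hitting_moment_2[OF chain.square_integrable_hitting_axioms, of s1] chain.half_D_nonneg assms(8,10) T1
    by (auto simp: chain.half_D_def)
  have T1sq: "T1sq = D + T1" using assms(10) by simp
  have B: "B\<^sup>2 = ctl.Bsq" "0 \<le> B\<^sup>2" using assms(11) by (auto simp: power_mult_distrib)
  \<comment> \<open>Since 2 \<open>half_D\<close> is D, the factor is 1 + D/T1 = T1sq/T1.\<close>
  have over: "ctl.overhead = B\<^sup>2 * T1sq / T1"
    unfolding ctl.overhead_def[OF V(2) assms(6)] using T1 D(1) B T1sq by (simp add: field_simps)
  have over_le: "ctl.overhead \<le> C * B\<^sup>2 / T1"
    unfolding over assms(9) using T1 B by (intro divide_right_mono) (auto simp: algebra_simps)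
  have over_le': "ctl.overhead \<le> C * B\<^sup>2"
  proof -
    have "0 \<le> C * B\<^sup>2" using T1 D B T1sq assms(9) by (intro mult_nonneg_nonneg) auto
    then have "C * B\<^sup>2 / T1 \<le> C * B\<^sup>2" using T1(2) by (simp add: divide_le_eq mult_le_cancel_left1)
    with over_le show ?thesis by linarith
  qed
  \<comment> \<open>Each competitor is compared separately on its own probability space; the link is
    that \<open>dual\<close> depends only on the network and \<pi>.\<close>
  have cost: "avg_cost N M S x \<le> A + ereal (C * B\<^sup>2 / (V * T1))"
    if A: "A = avg_cost N M' (\<lambda>t \<omega>. fst (\<omega> t)) (\<lambda>t \<omega>. snd (\<omega> t))"
      and stable: "stable_policy N s0 M' F' (\<lambda>t \<omega>. fst (\<omega> t)) (\<lambda>t \<omega>. snd (\<omega> t))"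
    for A and M' :: "(nat \<Rightarrow> 's \<times> 'a) measure" and F'
  proof -
    interpret other: feasible_policy N s0 M' F' "\<lambda>t \<omega>. fst (\<omega> t)" "\<lambda>t \<omega>. snd (\<omega> t)"
      using stable by (simp add: stable_policy_def)
    interpret other: controlled_network N \<pi> \<delta> s1 s0 M' F' "\<lambda>t \<omega>. fst (\<omega> t)" "\<lambda>t \<omega>. snd (\<omega> t)"
      by unfold_locales
    have le: "ereal (potential.dual V q / V) \<le> A" if "\<And>j. j \<in> potential.J \<Longrightarrow> 0 \<le> q j" for q
      unfolding A using stable that by (intro other.dual_le_avg_cost V) (auto simp: stable_policy_def)
    show ?thesis
    proof (cases A)
      case (real f)
      have "avg_cost N M S x \<le> ereal (f + ctl.overhead / V)"
      proof (rule ctl.QLA_avg_cost_le[OF V(2) assms(6) V(1)])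
        show "potential.dual V q \<le> V * f" if "\<And>j. j \<in> potential.J \<Longrightarrow> 0 \<le> q j" for q
          using le[OF that] V unfolding real by (simp add: divide_le_eq mult.commute)
      qed
      also have "\<dots> \<le> ereal (f + C * B\<^sup>2 / (V * T1))"
        using divide_right_mono[OF over_le V(2)] by (simp add: mult.commute)
      finally show ?thesis unfolding real by simp
    next
      \<comment> \<open>Excluded: the dual value at q = 0 is a finite lower bound for A.\<close>
      case MInf
      then show ?thesis using le[of "\<lambda>_. 0"] by simp
    qed simp
  qed
  \<comment> \<open>The finite constant is moved to the left first, so that a lower bound for every
    competitor bounds the infimum.\<close>
  have "avg_cost N M S x - ereal (C * B\<^sup>2 / (V * T1)) \<le> optimal_cost N s0"
    unfolding optimal_cost_def
    by (rule Inf_greatest) (use cost in \<open>auto simp: ereal_minus_le_iff add.commute\<close>)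
  then have "avg_cost N M S x \<le> optimal_cost N s0 + ereal (C * B\<^sup>2 / (V * T1))"
    by (simp add: ereal_minus_le_iff add.commute)
  moreover have "avg_backlog N M S x \<le> ereal ((C * B\<^sup>2 + T1 * V * \<delta>) / \<eta> + D * B\<^sup>2 / 2)"
  proof -
    have "V * \<delta> \<le> T1 * V * \<delta>"
      using T1(2) V net.\<delta>_pos by (simp add: mult_le_cancel_right1)
    \<comment> \<open>The derived backlog bound is weakened to the stated one, using T1 >= 1 and D
      >= 0.\<close>
    then have "(ctl.overhead + V * \<delta>) / \<eta> \<le> (C * B\<^sup>2 + T1 * V * \<delta>) / \<eta>"
      using over_le' assms(3) by (intro divide_right_mono) auto
    moreover have "0 \<le> D * B\<^sup>2 / 2" using D B by simp
    ultimately have "(ctl.overhead + V * \<delta>) / \<eta> \<le> (C * B\<^sup>2 + T1 * V * \<delta>) / \<eta> + D * B\<^sup>2 / 2"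
      by linarith
    then show ?thesis
      using ctl.QLA_avg_backlog_le[OF V(2) assms(6,4,3)] by (meson ereal_less_eq(3) order_trans)
  qed
  ultimately show ?thesis ..
qed

end
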